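(* Let $m,n,s,k$ be positive integers with $m+s=n+k$, and let $\mathbf{a}=(a_1,\ldots,a_s)$, $\mathbf{b}=(b_1,\ldots,b_k)$, $\mathbf{c}=(c_1,\ldots,c_n)$, $\mathbf{d}=(d_1,\ldots,d_m)$ be partitions (nonincreasing sequences of integers) such that $c_i\neq d_j$ for all $i\in\{1,\ldots,n\}$, $j\in\{1,\ldots,m\}$. Let $S,\Delta$, $h,h'$, $c^1\ge\cdots\ge c^{h'}$, $d^1\ge\cdots\ge d^{h}$, $m_y,t_y,z_y$, $m'_x,t'_x,z'_x$, $\mathbf{e}$, $\mathbf{e}'$ be as defined in the context. Then there exists a partition $\mathbf{g}=(g_1,\ldots,g_{m+s})$ such that $\mathbf{g}\prec''(\mathbf{d},\mathbf{a})$ and $\mathbf{g}\prec''(\mathbf{c},\mathbf{b})$ if and only if the following two conditions hold: (i) for every $y\in\{1,\ldots,h'\}$ with $t_y\le m_y$, $$\sum_{i=z_y+t_y}^{z_y+m_y}e_i\le \sum_{i=y}^{h'} c^i-\sum_{i\ge z_y+1,\ i\notin \Delta }d_i-\sum_{i=m_y+1}^s a_i;$$ (ii) for every $x\in\{1,\ldots,h\}$ with $t'_x\le m'_x$, $$\sum_{i=z'_x+t'_x}^{z'_x+m'_x}e'_i\le \sum_{i=x}^{h} d^i-\sum_{i\ge z'_x+1,\ i\notin S }c_i-\sum_{i=m'_x+1}^k b_i.$$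
   Context: Conventions: for any finite sequence $y_1,\ldots,y_w$, $\sum_{i=r}^{s}y_i=0$ if $r>s$, $y_i=+\infty$ for $i\le 0$ and $y_i=-\infty$ for $i>w$. Weak generalized majorization: for partitions $\mathbf{d}=(d_1,\ldots,d_m)$, $\mathbf{a}=(a_1,\ldots,a_s)$, $\mathbf{g}=(g_1,\ldots,g_{m+s})$, put $h_j:=\min\{i\mid d_{i-j+1}<g_i\}$ for $j=1,\ldots,s$. We write $\mathbf{g}\prec''(\mathbf{d},\mathbf{a})$ if (1) $d_i\ge g_{i+s}$ for $i=1,\ldots,m$; (2) $\sum_{i=h_j+1}^{m+s}g_i\ge\sum_{i=h_j-j+1}^{m}d_i+\sum_{i=j+1}^{s}a_i$ for $j=1,\ldots,s$; (3) $\sum_{i=1}^{m+s}g_i\ge\sum_{i=1}^m d_i+\sum_{i=1}^s a_i$. The relation $\mathbf{g}\prec''(\mathbf{c},\mathbf{b})$ is defined in the same way with $(\mathbf{c},\mathbf{b},n,k)$ in place of $(\mathbf{d},\mathbf{a},m,s)$. Unions: $\mathbf{e}=(e_1,\ldots,e_{m+s})$ is the nonincreasing rearrangement of $d_1,\ldots,d_m,a_1,\ldots,a_s$, where whenever some $a$'s equal some $d$'s, all those equal $a$'s are placed before the equal $d$'s. Similarly $\mathbf{e}'=(e'_1,\ldots,e'_{n+k})$ is the nonincreasing rearrangement of $c_1,\ldots,c_n,b_1,\ldots,b_k$, with equal $b$'s placed before equal $c$'s. Sets $S\subseteq\{1,\ldots,n\}$ and $\Delta\subseteq\{1,\ldots,m\}$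 are defined inductively. Start with both empty and process the elements of the multiset $\{c_1,\ldots,c_n\}\cup\{d_1,\ldots,d_m\}$ one at a time from the smallest to the largest; among equal $c$'s (resp. equal $d$'s) the one with largest index is processed first. At each step "$i\notin\Delta$" (resp. "$i\notin S$") refers to already processed indices not placed in $\Delta$ (resp. $S$), and $S,\Delta$ denote their current contents. If the processed element is $d_j$: set $q_j:=s-\#\{i\in S\mid c_i<d_j\}+\#\{i>j\mid i\notin\Delta\}+1$. If $q_j>s$, put $j\in\Delta$. If $q_j\le s$, let $l\in S$ be the minimal index with $d_j>c_l$ and let $N:=\#\{i\mid a_i>c_l\}-s+\#\{i\in S\mid i>l\}-\#\{i\notin\Delta\mid d_i<c_l\}+1$. (a) If $N\ge 1$ and $d_j$ is among the $N$ smallest entries of $\mathbf{e}$ that are bigger than $c_l$, put $j\notin\Delta$. (b) Otherwise, put $j\notin\Delta$ if $\sum_{c_i<d_j,\,i\in S}c_i\ge\sum_{i\notin\Delta,\,i>j}d_i+d_j+\sum_{i=q_j+1}^s a_i$, and put $j\in\Delta$ if this inequality fails. If the processed element is $c_j$: dually, set $q'_j:=k-\#\{i\in\Delta\mid d_i<c_j\}+\#\{i>j\mid i\notin S\}+1$. If $q'_j>k$, put $j\in S$. If $q'_j\le k$, let $l\in\Delta$ be the minimal index with $c_j>d_l$ and $N':=\#\{i\mid b_i>d_l\}-k+\#\{i\in\Delta\mid i>l\}-\#\{i\notin S\mid c_i<d_l\}+1$. (a) If $N'\ge1$ and $c_j$ is among the $N'$ smallest entries of $\mathbf{e}'$ bigger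 than $d_l$, put $j\notin S$. (b) Otherwise put $j\notin S$ if $\sum_{d_i<c_j,\,i\in\Delta}d_i\ge\sum_{i\notin S,\,i>j}c_i+c_j+\sum_{i=q'_j+1}^k b_i$, and $j\in S$ if it fails. After the construction, let $h=\#\Delta$, $h'=\#S$; let $d^1\ge\cdots\ge d^h$ be the $d_i$ with $i\in\Delta$ and $c^1\ge\cdots\ge c^{h'}$ the $c_i$ with $i\in S$ (in order of indices). For $j=1,\ldots,h'$: $m_j:=\#\{i\mid a_i>c^j\}$, $t_j:=s-(h'-j)+\#\{i\notin\Delta\mid d_i<c^j\}$, $z_j:=\#\{i\mid d_i>c^j\}$. For $j=1,\ldots,h$: $m'_j:=\#\{i\mid b_i>d^j\}$, $t'_j:=k-(h-j)+\#\{i\notin S\mid c_i<d^j\}$, $z'_j:=\#\{i\mid c_i>d^j\}$. Here $i\notin\Delta$ means $i\in\{1,\ldots,m\}\setminus\Delta$ and $i\notin S$ means $i\in\{1,\ldots,n\}\setminus S$. *)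

theory Defs
  imports "HOL-Library.Extended_Real" "HOL-Library.Product_Lexorder"
begin

definition nth1 :: "int list \<Rightarrow> nat \<Rightarrow> int" where
  "nth1 xs i = xs ! (i - 1)"

definition is_partition :: "int list \<Rightarrow> bool" where
  "is_partition xs \<longleftrightarrow> sorted_wrt (\<ge>) xs"

definition ev :: "int list \<Rightarrow> int \<Rightarrow> ereal" where
  "ev xs i = (if i \<le> 0 then \<infinity> else if i > int (length xs) then -\<infinity>
              else ereal (xs ! nat (i - 1)))"

definition esum :: "int list \<Rightarrow> int \<Rightarrow> int \<Rightarrow> ereal" where
  "esum xs r t = (\<Sum>i\<in>{r..t}. ev xs i)"

definition hidx :: "int list \<Rightarrow> int list \<Rightarrow> nat \<Rightarrow> nat" where
  "hidx g d j = (LEAST i::nat. ev d (int i - int j + 1) < ev g (int i))"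

definition wgmaj :: "int list \<Rightarrow> int list \<Rightarrow> int list \<Rightarrow> bool" where
  "wgmaj g d a \<longleftrightarrow>
     (let m = length d; s = length a in
       (\<forall>i\<in>{1..m}. ev d (int i) \<ge> ev g (int (i + s))) \<and>
       (\<forall>j\<in>{1..s}.
          esum g (int (hidx g d j) + 1) (int (m + s)) \<ge>
          esum d (int (hidx g d j) - int j + 1) (int m) + esum a (int j + 1) (int s)) \<and>
       esum g 1 (int (m + s)) \<ge> esum d 1 (int m) + esum a 1 (int s))"

definition union_tags :: "int list \<Rightarrow> int list \<Rightarrow> (int \<times> nat \<times> nat) list" where
  "union_tags u x =
     sort_key (\<lambda>(v, t, i). (- v, t, i))
       ([(u ! i, 0, i + 1). i \<leftarrow> [0..<length u]] @ [(x ! i, 1, i + 1). i \<leftarrow> [0..<length x]])"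

definition union_seq :: "int list \<Rightarrow> int list \<Rightarrow> int list" where
  "union_seq u x = map fst (union_tags u x)"

definition among_smallest :: "int list \<Rightarrow> int list \<Rightarrow> nat \<Rightarrow> int \<Rightarrow> int \<Rightarrow> bool" where
  "among_smallest u x j v N \<longleftrightarrow>
     (let T = union_tags u x; L = length T in
       \<exists>p\<in>{1..L}. snd (T ! (p - 1)) = (1, j) \<and> fst (T ! (p - 1)) > v \<and>
          int (card {p'\<in>{1..L}. fst (T ! (p' - 1)) > v \<and> p' \<ge> p}) \<le> N)"

text \<open>Decision when processing x_j (x = d, u = a, y = c, Y = S, ND = processed indices
  of x not placed in the own set; or dually x = c, u = b, y = d, Y = Delta).
  Returns True iff j is put into the own set (Delta, resp. S).\<close>
definition goes_in :: "int list \<Rightarrow> int list \<Rightarrow> int list \<Rightarrow> nat set \<Rightarrow> nat set \<Rightarrow> nat \<Rightarrow> bool" where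
  "goes_in x u y Y ND j =
     (let s = length u;
          q = int s - int (card {i\<in>Y. nth1 y i < nth1 x j}) + int (card {i\<in>ND. i > j}) + 1
      in if q > int s then True
         else
          (let l = Min {i\<in>Y. nth1 x j > nth1 y i};
               N = int (card {i\<in>{1..s}. nth1 u i > nth1 y l}) - int s
                   + int (card {i\<in>Y. i > l}) - int (card {i\<in>ND. nth1 x i < nth1 y l}) + 1
           in if N \<ge> 1 \<and> among_smallest u x j (nth1 y l) N then False
              else \<not> (ereal (\<Sum>i\<in>{i\<in>Y. nth1 y i < nth1 x j}. nth1 y i) \<ge>
                       ereal (\<Sum>i\<in>{i\<in>ND. i > j}. nth1 x i) + ereal (nth1 x j)
                       + esum u (q + 1) (int s))))"

text \<open>State: (pc, pd, S, Delta); c-indices 1..pc and d-indices 1..pd are unprocessed.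
  The smallest unprocessed element is processed next (c's resp. d's in order of
  decreasing index).\<close>
definition SD_step :: "int list \<Rightarrow> int list \<Rightarrow> int list \<Rightarrow> int list \<Rightarrow>
     nat \<times> nat \<times> nat set \<times> nat set \<Rightarrow> nat \<times> nat \<times> nat set \<times> nat set" where
  "SD_step a b c d st =
     (case st of (pc, pd, S, D) \<Rightarrow>
       if pd > 0 \<and> (pc = 0 \<or> nth1 d pd < nth1 c pc) then
         (let ND = {pd + 1..length d} - D in
          (pc, pd - 1, S, if goes_in d a c S ND pd then insert pd D else D))
       else if pc > 0 then
         (let NS = {pc + 1..length c} - S in
          (pc - 1, pd, if goes_in c b d D NS pc then insert pc S else S, D))
       else st)"

definition SD_final :: "int list \<Rightarrow> int list \<Rightarrow> int list \<Rightarrow> int list \<Rightarrow> nat set \<times> nat set" where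
  "SD_final a b c d =
     (case (SD_step a b c d ^^ (length c + length d)) (length c, length d, {}, {}) of
        (_, _, S, D) \<Rightarrow> (S, D))"

definition Sset :: "int list \<Rightarrow> int list \<Rightarrow> int list \<Rightarrow> int list \<Rightarrow> nat set" where
  "Sset a b c d = fst (SD_final a b c d)"

definition Dset :: "int list \<Rightarrow> int list \<Rightarrow> int list \<Rightarrow> int list \<Rightarrow> nat set" where
  "Dset a b c d = snd (SD_final a b c d)"

definition sub_elem :: "int list \<Rightarrow> nat set \<Rightarrow> nat \<Rightarrow> int" where
  "sub_elem x I j = nth1 x (sorted_list_of_set I ! (j - 1))"

text \<open>Condition (i) (and dually (ii), with x = c, u = a, y = d, I = S, J = Delta):
  for y in 1..h', with c^y = sub_elem c S y,
  m_y = #{i | a_i > c^y}, t_y = s - (h'-y) + #{i notin Delta | d_i < c^y},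
  z_y = #{i | d_i > c^y}.\<close>
definition cond_side :: "int list \<Rightarrow> int list \<Rightarrow> int list \<Rightarrow> nat set \<Rightarrow> nat set \<Rightarrow> bool" where
  "cond_side x u y I J =
     (let h' = card I; s = length u; e = union_seq u y in
      \<forall>w\<in>{1..h'}.
        (let cw = sub_elem x I w;
             mw = int (card {i\<in>{1..s}. nth1 u i > cw});
             tw = int s - (int h' - int w) + int (card {i\<in>{1..length y} - J. nth1 y i < cw});
             zw = int (card {i\<in>{1..length y}. nth1 y i > cw})
         in tw \<le> mw \<longrightarrow>
            esum e (zw + tw) (zw + mw) \<le>
              ereal (\<Sum>i\<in>{w..h'}. sub_elem x I i)
              - ereal (\<Sum>i\<in>{i\<in>{1..length y} - J. int i \<ge> zw + 1}. nth1 y i)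
              - esum u (mw + 1) (int s)))"

end

theory Submission
  imports Defs "HOL-Library.Multiset"
begin

text \<open>
  Read from the top, \<open>g\<close> either matches the next entry of \<open>d\<close> (if it does not exceed it) or
  uses up the next entry of \<open>a\<close>; \<open>g \<prec>'' (d, a)\<close> says that every tail of \<open>g\<close> has at least the
  sum of the entries of \<open>d\<close> and \<open>a\<close> left over at that point.

  Let \<open>G\<close> be the nonincreasing list of the selected values \<open>c\<^sub>i\<close> (\<open>i \<in> S\<close>) and \<open>d\<^sub>j\<close>
  (\<open>j \<in> \<Delta>\<close>). Rule (a) of the construction just says that fewer than \<open>s - q\<^sub>j + 1\<close> of the \<open>a\<close>'s
  are smaller than \<open>d\<^sub>j\<close>. Conditions (i) and (ii) say that each tail of \<open>G\<close> that starts
  with a \<open>c\<close> (respectively a \<open>d\<close>) and cannot be paid by small \<open>a\<close>'s (respectively \<open>b\<close>'s) has at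
  least the sum of equally many smallest entries of the union \<open>e\<close> (respectively \<open>e'\<close>).

  Aligned at the bottom, \<open>G\<close> dominates every solution \<open>g\<close> entrywise: an element
  is selected only when \<open>g\<close> cannot avoid having an entry that small. As every tail of
  a solution is at least the corresponding tail of the union, (i) and (ii) are necessary.
  Conversely, under (i) and (ii), padding \<open>G\<close> at the top with large entries gives a solution.
\<close>

section \<open>Weak generalized majorization by tail sums\<close>

lemma partition_nth_mono:
  assumes "is_partition xs" "i \<le> j" "j < length xs"
  shows "xs ! j \<le> xs ! i"
  using assms unfolding is_partition_def
  by (metis le_neq_implies_less order_refl sorted_wrt_nth_less)

lemma sum_list_drop_nth:
  fixes xs :: "int list"
  assumes "p \<le> q" "q \<le> length xs"
  shows "sum_list (drop p xs) = (\<Sum>i=p..<q. xs ! i) + sum_list (drop q xs)"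
  using assms
proof (induction q)
  case 0
  then show ?case by simp
next
  case (Suc q)
  show ?case
  proof (cases "p = Suc q")
    case False
    with Suc.prems have "p \<le> q" "q < length xs" by auto
    moreover have "sum_list (drop q xs) = xs ! q + sum_list (drop (Suc q) xs)"
      by (simp add: Cons_nth_drop_Suc[OF \<open>q < length xs\<close>, symmetric])
    ultimately show ?thesis using Suc.IH by simp
  qed simp
qed

lemma sum_list_drop_Suc:
  fixes xs :: "int list"
  shows "q < length xs \<Longrightarrow> sum_list (drop q xs) = xs ! q + sum_list (drop (Suc q) xs)"
  by (simp add: Cons_nth_drop_Suc[symmetric])

lemma ev_nth: "i < length xs \<Longrightarrow> ev xs (int i + 1) = ereal (real_of_int (xs ! i))"
  by (simp add: ev_def)

lemma esum_segment:
  assumes "p \<le> q" "q \<le> length xs"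
  shows "esum xs (int p + 1) (int q) = ereal (real_of_int (sum_list (drop p xs) - sum_list (drop q xs)))"
proof -
  have "{int p + 1..int q} = (\<lambda>i. int i + 1) ` {p..<q}"
  proof (intro equalityI subsetI)
    fix x assume "x \<in> {int p + 1..int q}"
    then show "x \<in> (\<lambda>i. int i + 1) ` {p..<q}"
      by (intro image_eqI[of _ _ "nat (x - 1)"]) auto
  qed auto
  then have "esum xs (int p + 1) (int q) = (\<Sum>i=p..<q. ev xs (int i + 1))"
    unfolding esum_def by (simp add: sum.reindex inj_on_def o_def)
  also have "\<dots> = (\<Sum>i=p..<q. ereal (real_of_int (xs ! i)))"
    using assms by (intro sum.cong refl ev_nth) auto
  also have "\<dots> = ereal (real_of_int (\<Sum>i=p..<q. xs ! i))"
    by simp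
  finally show ?thesis
    using sum_list_drop_nth[OF assms] by simp
qed

lemma esum_tail:
  assumes "p \<le> length xs" "r = int p + 1" "t = int (length xs)"
  shows "esum xs r t = ereal (real_of_int (sum_list (drop p xs)))"
  using esum_segment[of p "length xs" xs] assms by simp

text \<open>By the convention for indices at most 0. This is what makes condition (i) fail for a
  tail of \<open>G\<close> that has more entries than the whole union.\<close>

lemma esum_PInf:
  assumes "r \<le> 0" "r \<le> t"
  shows "esum xs r t = \<infinity>"
  unfolding esum_def sum_Pinfty using assms by (auto simp: ev_def intro: bexI[of _ r])

text \<open>The value \<open>+\<infinity>\<close> of \<open>d\<close> before its first entry rules
  out indices below \<open>j\<close>, and the value \<open>-\<infinity>\<close> after its last entry
  makes \<open>length d + j\<close> qualify. The remaining claims are the least-index property with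
  lists counted from 0.\<close>

lemma hidx_props:
  fixes g d a :: "int list"
  assumes "length g = length d + length a" "1 \<le> j" "j \<le> length a"
  shows "j \<le> hidx g d j" "hidx g d j \<le> length d + j"
    and "hidx g d j - j < length d \<Longrightarrow> d ! (hidx g d j - j) < g ! (hidx g d j - 1)"
    and "\<And>i. j \<le> Suc i \<Longrightarrow> Suc i < hidx g d j \<Longrightarrow> Suc i - j < length d \<and> g ! i \<le> d ! (Suc i - j)"
proof -
  define P where "P i \<longleftrightarrow> ev d (int i - int j + 1) < ev g (int i)" for i
  define h where "h = hidx g d j"
  have h: "h = (LEAST i. P i)"
    unfolding h_def hidx_def P_def ..
  have ex: "P (length d + j)"
    using assms unfolding P_def ev_def by auto
  have Ph: "P h"
    unfolding h using ex by (rule LeastI)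
  have le: "h \<le> length d + j"
    unfolding h using ex by (rule Least_le)
  have ge: "j \<le> h"
  proof (rule ccontr)
    assume "\<not> j \<le> h"
    then have "ev d (int h - int j + 1) = \<infinity>" unfolding ev_def by auto
    with Ph show False unfolding P_def by simp
  qed
  show "j \<le> hidx g d j" "hidx g d j \<le> length d + j"
    using ge le by (simp_all add: h_def)
  show "d ! (hidx g d j - j) < g ! (hidx g d j - 1)" if "hidx g d j - j < length d"
  proof -
    have "ev d (int h - int j + 1) = ereal (d ! (h - j))"
      using that ge by (simp add: ev_def h_def[symmetric] nat_diff_distrib')
    moreover have "ev g (int h) = ereal (g ! (h - 1))"
      using assms le ge by (simp add: ev_def nat_diff_distrib')
    ultimately show ?thesis
      using Ph unfolding P_def by (simp add: h_def)
  qed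
  show "Suc i - j < length d \<and> g ! i \<le> d ! (Suc i - j)"
    if i: "j \<le> Suc i" "Suc i < hidx g d j" for i
  proof -
    have "\<not> P (Suc i)"
      using i(2) not_less_Least unfolding h_def[symmetric] h by blast
    moreover have lt: "Suc i - j < length d"
      using le i unfolding h_def[symmetric] by linarith
    moreover have "ev d (int (Suc i) - int j + 1) = ereal (d ! (Suc i - j))"
      using ev_nth[OF lt] i(1) by (simp add: of_nat_diff)
    moreover have "ev g (int (Suc i)) = ereal (g ! i)"
      using assms le i unfolding h_def[symmetric] by (simp add: ev_def)
    ultimately show ?thesis unfolding P_def by simp
  qed
qed

lemma wgmaj_iff:
  assumes len: "length g = length d + length a"
  shows "wgmaj g d a \<longleftrightarrow> (\<forall>i<length d. g ! (i + length a) \<le> d ! i) \<and>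
    (\<forall>j\<in>{1..length a}. sum_list (drop (hidx g d j - j) d) + sum_list (drop j a)
        \<le> sum_list (drop (hidx g d j) g)) \<and>
    sum_list d + sum_list a \<le> sum_list g"
proof -
  have 1: "(\<forall>i\<in>{1..length d}. ev d (int i) \<ge> ev g (int (i + length a))) \<longleftrightarrow>
      (\<forall>i<length d. g ! (i + length a) \<le> d ! i)"
  proof -
    have "ev d (int (Suc i)) \<ge> ev g (int (Suc i + length a)) \<longleftrightarrow> g ! (i + length a) \<le> d ! i"
      if "i < length d" for i
      using that len by (simp add: ev_def nat_diff_distrib' nat_add_distrib)
    then have "(\<forall>i\<in>{..<length d}. ev d (int (Suc i)) \<ge> ev g (int (Suc i + length a))) \<longleftrightarrow>
      (\<forall>i<length d. g ! (i + length a) \<le> d ! i)" by auto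
    then show ?thesis
      unfolding image_Suc_lessThan[symmetric] by blast
  qed
  have 2: "esum d (int (hidx g d j) - int j + 1) (int (length d)) + esum a (int j + 1) (int (length a))
       \<le> esum g (int (hidx g d j) + 1) (int (length d + length a)) \<longleftrightarrow>
      sum_list (drop (hidx g d j - j) d) + sum_list (drop j a) \<le> sum_list (drop (hidx g d j) g)"
    if j: "j \<in> {1..length a}" for j
  proof -
    note h = hidx_props(1,2)[OF len, of j]
    have e: "esum d (int (hidx g d j) - int j + 1) (int (length d))
        = ereal (sum_list (drop (hidx g d j - j) d))"
      using h j by (intro esum_tail) auto
    have "esum a (int j + 1) (int (length a)) = ereal (sum_list (drop j a))"
      using j by (intro esum_tail) auto
    moreover have "esum g (int (hidx g d j) + 1) (int (length d + length a))
        = ereal (sum_list (drop (hidx g d j) g))"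
      using h j len by (intro esum_tail) auto
    ultimately show ?thesis unfolding e by (simp flip: of_int_add)
  qed
  have 3: "esum d 1 (int (length d)) + esum a 1 (int (length a)) \<le> esum g 1 (int (length d + length a))
      \<longleftrightarrow> sum_list d + sum_list a \<le> sum_list g"
    using esum_tail[of 0 d] esum_tail[of 0 a] esum_tail[of 0 g] len by (simp flip: of_int_add)
  show ?thesis
    unfolding wgmaj_def Let_def 1 using 2 3 by auto
qed

text \<open>While entries of \<open>g\<close> are matched with entries of \<open>d\<close> at the
  fixed offset \<open>k\<close>, each pair takes at least as much from the tail of \<open>d\<close>
  as from that of \<open>g\<close>.\<close>

lemma tail_sums_match:
  fixes g d a :: "int list"
  assumes base: "sum_list (drop (h - k) d) + A \<le> sum_list (drop h g)"
    and "k \<le> h" "h \<le> t" "t \<le> length g" "t - k \<le> length d"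
    and match: "\<And>i. h \<le> i \<Longrightarrow> i < t \<Longrightarrow> g ! i \<le> d ! (i - k)"
  shows "sum_list (drop (t - k) d) + A \<le> sum_list (drop t g)"
proof -
  have "(\<Sum>i=h..<t. g ! i) \<le> (\<Sum>i=h..<t. d ! (i - k))"
    by (rule sum_mono) (use match in auto)
  also have "\<dots> = (\<Sum>i=h-k..<t-k. d ! i)"
    using sum.shift_bounds_nat_ivl[of "\<lambda>i. d ! (i - k)" "h - k" k "t - k"] assms by simp
  finally show ?thesis
    using base sum_list_drop_nth[of h t g] sum_list_drop_nth[of "h - k" "t - k" d] assms by simp
qed

text \<open>The relation bounds tails only at insertion positions. Any other cut \<open>t\<close>
  inherits the bound from the last insertion up to \<open>t\<close>, because after it
  \<open>g\<close> only matches \<open>d\<close>.\<close>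

lemma wgmaj_tail:
  assumes len: "length g = length d + length a"
    and part: "is_partition g"
    and maj: "wgmaj g d a" and t: "t \<le> length g"
  obtains k where "k \<le> length a" "k \<le> t" "t - k \<le> length d"
    "sum_list (drop (t - k) d) + sum_list (drop k a) \<le> sum_list (drop t g)"
    "k < t \<Longrightarrow> g ! (t - 1) \<le> d ! (t - k - 1)"
proof -
  \<comment> \<open>The value 0 at \<open>j = 0\<close> lets condition (3) act as the bound before
    any insertion.\<close>
  define H where "H j = (if j = 0 then 0 else hidx g d j)" for j
  define J where "J = {j. j \<le> length a \<and> H j \<le> t}"
  have J: "finite J" "0 \<in> J" by (auto simp: J_def H_def)
  define k where "k = Max J"
  have kJ: "k \<in> J" unfolding k_def using J by (intro Max_in) auto
  then have k: "k \<le> length a" "H k \<le> t" by (auto simp: J_def)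
  have kH: "k \<le> H k" using k hidx_props(1)[OF len, of k] by (auto simp: H_def)
  have next_gt: "t < H (Suc k)" if "k < length a"
  proof (rule ccontr)
    assume "\<not> t < H (Suc k)"
    with that have "Suc k \<in> J" by (auto simp: J_def)
    then show False using Max_ge[OF J(1)] unfolding k_def by fastforce
  qed
  have match: "i - k < length d \<and> g ! i \<le> d ! (i - k)" if i: "H k \<le> i" "i < t" for i
  proof (cases "k < length a")
    case True
    then show ?thesis
      using hidx_props(4)[OF len, of "Suc k" i] next_gt i kH by (simp add: H_def)
  next
    case False
    \<comment> \<open>With all of \<open>a\<close> inserted, the matching is condition (1).\<close>
    then have "k = length a" using k by simp
    moreover have "i - length a < length d" using i t len \<open>k = length a\<close> kH by linarith
    moreover have "g ! (i - length a + length a) \<le> d ! (i - length a)"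
      using maj[unfolded wgmaj_iff[OF len]] calculation by blast
    moreover have "i - length a + length a = i" using i kH \<open>k = length a\<close> by simp
    ultimately show ?thesis by simp
  qed
  have tk: "t - k \<le> length d"
  proof (cases "H k < t")
    case True
    then have "t - 1 - k < length d" using match[of "t - 1"] by auto
    then show ?thesis by linarith
  next
    case False
    then have "H k = t" using k by simp
    then show ?thesis using k hidx_props(2)[OF len, of k] by (cases "k = 0") (auto simp: H_def)
  qed
  have base: "sum_list (drop (H k - k) d) + sum_list (drop k a) \<le> sum_list (drop (H k) g)"
    using maj[unfolded wgmaj_iff[OF len]] k by (cases "k = 0") (auto simp: H_def)
  have "sum_list (drop (t - k) d) + sum_list (drop k a) \<le> sum_list (drop t g)"
    by (rule tail_sums_match[OF base kH k(2) t tk]) (use match in auto)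
  moreover have "g ! (t - 1) \<le> d ! (t - k - 1)" if "k < t"
  proof (cases "H k < t")
    case True
    then show ?thesis using match[of "t - 1"] by (simp add: diff_right_commute)
  next
    case False
    then have H: "H k = t" using k by simp
    with that have "k \<noteq> 0" by (cases "k = 0") (auto simp: H_def)
    \<comment> \<open>Now \<open>g ! (t - 1)\<close> is the inserted entry itself; the bound comes
      from the matched entry just before it.\<close>
    then have "g ! (t - 2) \<le> d ! (t - k - 1)"
      using hidx_props(4)[OF len, of k "t - 2"] H that k by (auto simp: H_def Suc_diff_Suc numeral_2_eq_2 diff_right_commute)
    moreover have "g ! (t - 1) \<le> g ! (t - 2)"
      by (rule partition_nth_mono[OF part]) (use that t in auto)
    ultimately show ?thesis by simp
  qed
  moreover have "k \<le> t" using k kH by simp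
  ultimately show ?thesis using that[of k] k(1) tk by blast
qed

text \<open>Going from one insertion to the next, the slack only decreases at the insertion itself,
  and only if the inserted \<open>a\<close> is smaller than the corresponding entry of \<open>g\<close>.\<close>
lemma wgmajI:
  assumes len: "length g = length d + length a"
    and part: "is_partition g" "is_partition d"
    and c1: "\<And>i. i < length d \<Longrightarrow> g ! (i + length a) \<le> d ! i"
    and c3: "sum_list d + sum_list a \<le> sum_list g"
    and c2: "\<And>h j. 1 \<le> j \<Longrightarrow> j \<le> length a \<Longrightarrow> j \<le> h \<Longrightarrow> h \<le> length d + j \<Longrightarrow>
      (h - j < length d \<Longrightarrow> d ! (h - j) < g ! (h - 1)) \<Longrightarrow>
      (j < h \<Longrightarrow> g ! (h - 1) \<le> d ! (h - j - 1)) \<Longrightarrow> a ! (j - 1) < g ! (h - 1) \<Longrightarrow>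
      sum_list (drop (h - j) d) + sum_list (drop j a) \<le> sum_list (drop h g)"
  shows "wgmaj g d a"
proof -
  define H where "H j = (if j = 0 then 0 else hidx g d j)" for j
  have "sum_list (drop (H j - j) d) + sum_list (drop j a) \<le> sum_list (drop (H j) g)"
    if "j \<le> length a" for j
    using that
  proof (induction j)
    case 0
    then show ?case using c3 by (simp add: H_def)
  next
    case (Suc j)
    define h where "h = H (Suc j)"
    have hh: "h = hidx g d (Suc j)" by (simp add: h_def H_def)
    note hp = hidx_props[OF len, of "Suc j", folded hh]
    have h1: "Suc j \<le> h" "h \<le> length d + Suc j"
      and h2: "h - Suc j < length d \<Longrightarrow> d ! (h - Suc j) < g ! (h - 1)"
      and h3: "\<And>i. j \<le> i \<Longrightarrow> Suc i < h \<Longrightarrow> i - j < length d \<and> g ! i \<le> d ! (i - j)"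
      using hp Suc.prems by auto
    have hlen: "h - 1 < length g" using h1 len Suc.prems by linarith
    show ?case
    proof (cases "a ! j < g ! (h - 1)")
      case True
      have "g ! (h - 1) \<le> d ! (h - Suc j - 1)" if "Suc j < h"
      proof -
        have "g ! (h - 2) \<le> d ! (h - 2 - j)" using h3[of "h - 2"] that by (simp add: Suc_diff_Suc numeral_2_eq_2)
        moreover have "g ! (h - 1) \<le> g ! (h - 2)"
          by (rule partition_nth_mono[OF part(1)]) (use hlen in auto)
        moreover have "h - 2 - j = h - Suc j - 1" by simp
        ultimately show ?thesis by simp
      qed
      then show ?thesis
        unfolding h_def[symmetric] using c2[of "Suc j" h] h1 h2 Suc.prems True by simp
    next
      case False
      have Hj: "j \<le> H j" using hidx_props(1)[OF len, of j] Suc.prems by (simp add: H_def)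
      \<comment> \<open>Insertion positions strictly increase: otherwise minimality of
        \<open>H j\<close> would bound \<open>g ! (h - 1)\<close> by \<open>d ! (h - Suc j)\<close>,
        against the defining inequality at \<open>h\<close>.\<close>
      have "H j < h"
      proof (cases "j = 0")
        case True
        then show ?thesis using h1 by (simp add: H_def)
      next
        case j: False
        note hj = hidx_props(4)[OF len, of j]
        show ?thesis
        proof (rule ccontr)
          assume "\<not> H j < h"
          then consider "h < H j" | "h = H j" by linarith
          then show False
          proof cases
            case 1
            have "h - j < length d \<and> g ! (h - 1) \<le> d ! (h - j)"
              using hj[of "h - 1"] 1 j Suc.prems h1 by (simp add: H_def)
            moreover from this have "d ! (h - j) \<le> d ! (h - Suc j)"
              by (intro partition_nth_mono[OF part(2)]) auto
            moreover have "d ! (h - Suc j) < g ! (h - 1)" using h2 calculation h1 by linarith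
            ultimately show False by linarith
          next
            case 2
            have "h - 1 - j < length d \<and> g ! (h - 2) \<le> d ! (h - 1 - j)"
              using hj[of "h - 2"] 2 j Suc.prems h1
              by (simp add: H_def Suc_diff_Suc numeral_2_eq_2)
            moreover have "g ! (h - 1) \<le> g ! (h - 2)"
              by (rule partition_nth_mono[OF part(1)]) (use hlen in auto)
            moreover have "h - 1 - j = h - Suc j" by simp
            ultimately show False using h2 by force
          qed
        qed
      qed
      have "sum_list (drop (h - 1 - j) d) + sum_list (drop j a) \<le> sum_list (drop (h - 1) g)"
        by (rule tail_sums_match[OF Suc.IH])
          (use Suc.prems Hj \<open>H j < h\<close> hlen h1 h3 in auto)
      moreover have "sum_list (drop (h - 1) g) = g ! (h - 1) + sum_list (drop h g)"
        using sum_list_drop_Suc[OF hlen] h1 by simp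
      moreover have "sum_list (drop j a) = a ! j + sum_list (drop (Suc j) a)"
        by (rule sum_list_drop_Suc) (use Suc.prems in auto)
      ultimately show ?thesis
        unfolding h_def[symmetric] using False by simp
    qed
  qed
  note H_tails = this
  have "sum_list (drop (hidx g d j - j) d) + sum_list (drop j a) \<le> sum_list (drop (hidx g d j) g)"
    if "j \<in> {1..length a}" for j
    using H_tails[of j] that by (simp add: H_def)
  then show ?thesis
    unfolding wgmaj_iff[OF len] using c1 c3 by blast
qed

section \<open>Tails of the union\<close>

lemma
  shows mset_union_seq: "mset (union_seq u x) = mset u + mset x"
    and length_union_seq: "length (union_seq u x) = length u + length x"
    and partition_union_seq: "is_partition (union_seq u x)"
proof -
  let ?l = "map (\<lambda>i. (u ! i, 0::nat, i + 1)) [0..<length u] @ map (\<lambda>i. (x ! i, 1::nat, i + 1)) [0..<length x]"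
  let ?f = "\<lambda>(v::int, t::nat, i::nat). (- v, t, i)"
  have tags: "union_tags u x = sort_key ?f ?l"
    by (simp add: union_tags_def)
  have "mset (union_seq u x) = mset (map fst ?l)"
    unfolding union_seq_def tags mset_map mset_sort ..
  also have "map fst ?l = map ((!) u) [0..<length u] @ map ((!) x) [0..<length x]"
    by (simp add: o_def)
  finally show "mset (union_seq u x) = mset u + mset x"
    by (simp only: map_nth mset_append)
  then show "length (union_seq u x) = length u + length x"
    by (metis size_mset size_union)
  have "sorted (map ?f (union_tags u x))"
    unfolding tags by simp
  then have "sorted_wrt (\<lambda>p q. ?f p \<le> ?f q) (union_tags u x)"
    by (simp add: sorted_wrt_map)
  then have "sorted_wrt (\<lambda>p q. fst p \<ge> fst q) (union_tags u x)"
    by (rule sorted_wrt_mono_rel[rotated]) (auto simp: less_eq_prod_def split: prod.splits)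
  then show "is_partition (union_seq u x)"
    unfolding is_partition_def union_seq_def by (simp add: sorted_wrt_map)
qed

lemma partition_unique:
  assumes "is_partition xs" "is_partition ys" "mset xs = mset ys"
  shows "xs = ys"
proof -
  have "sorted (rev xs)" "sorted (rev ys)"
    using assms(1,2) by (auto simp: is_partition_def sorted_wrt_rev)
  moreover have "mset (rev xs) = mset (rev ys)" using assms(3) by simp
  ultimately have "rev xs = rev ys"
    by (metis properties_for_sort)
  then show ?thesis by simp
qed

text \<open>A threshold argument: with \<open>th\<close> the first entry of the tail, the truncation
  \<open>f\<close> of \<open>x - th\<close> at 0 vanishes before the tail and equals
  \<open>x - th\<close> on it. As \<open>f\<close> is nonpositive, its sum over all of
  \<open>e\<close> is at most its sum over \<open>M\<close>.\<close>

lemma sum_smallest_le: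
  fixes e :: "int list"
  assumes e: "is_partition e" and M: "M \<subseteq># mset e"
  shows "sum_list (drop (length e - size M) e) \<le> sum_mset M"
proof (cases "M = {#}")
  case False
  define q where "q = length e - size M"
  have size: "size M \<le> length e" using size_mset_mono[OF M] by simp
  then have q: "q < length e" using False unfolding q_def by (simp add: nonempty_has_size)
  define th where "th = e ! q"
  define f where "f x = min (x - th) 0" for x
  have "(\<Sum>x\<leftarrow>drop q e. x - th) = (\<Sum>x\<leftarrow>drop q e. f x)"
  proof (rule arg_cong[of _ _ sum_list], rule map_cong[OF refl])
    fix x assume "x \<in> set (drop q e)"
    then obtain i where "i < length e - q" "x = e ! (q + i)"
      by (auto simp: in_set_conv_nth)
    then have "x \<le> th"
      unfolding th_def using partition_nth_mono[OF e, of q "q + i"] by auto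
    then show "x - th = f x" by (simp add: f_def)
  qed
  also have "\<dots> = (\<Sum>x\<leftarrow>e. f x)"
  proof -
    have "(\<Sum>x\<leftarrow>take q e. f x) = 0"
    proof -
      have "f x = 0" if xt: "x \<in> set (take q e)" for x
      proof -
        obtain i where "i < q" "x = e ! i"
          using xt q by (auto simp: in_set_conv_nth)
        then have "th \<le> x"
          unfolding th_def using partition_nth_mono[OF e, of i q] q by auto
        then show ?thesis by (simp add: f_def)
      qed
      then show ?thesis by (simp add: sum_list_nonneg_eq_0_iff cong: map_cong)
    qed
    moreover have "(\<Sum>x\<leftarrow>e. f x) = (\<Sum>x\<leftarrow>take q e. f x) + (\<Sum>x\<leftarrow>drop q e. f x)"
      by (metis append_take_drop_id map_append sum_list_append)
    ultimately show ?thesis by simp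
  qed
  also have "\<dots> = sum_mset (image_mset f (mset e))"
    by (simp flip: sum_mset_sum_list mset_map)
  also have "\<dots> \<le> sum_mset (image_mset f M)"
  proof -
    have "mset e = M + (mset e - M)" using M by simp
    then have "sum_mset (image_mset f (mset e)) = sum_mset (image_mset f M) + sum_mset (image_mset f (mset e - M))"
      by (metis image_mset_union sum_mset.union)
    moreover have "sum_mset (image_mset f N) \<le> 0" for N
      by (induction N) (auto simp: f_def)
    ultimately show ?thesis by (metis add.right_neutral add_left_mono)
  qed
  also have "\<dots> \<le> sum_mset (image_mset (\<lambda>x. x - th) M)"
    by (rule sum_mset_mono) (auto simp: f_def)
  also have "\<dots> = sum_mset M - int (size M) * th"
    by (induction M) (auto simp: algebra_simps)
  also have "(\<Sum>x\<leftarrow>drop q e. x - th) = sum_list (drop q e) - int (size M) * th"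
  proof -
    have "(\<Sum>x\<leftarrow>ys. x - th) = sum_list ys - int (length ys) * th" for ys
      by (induction ys) (auto simp: algebra_simps)
    moreover have "length (drop q e) = size M" using size q unfolding q_def by simp
    ultimately show ?thesis by metis
  qed
  finally show ?thesis by (simp add: q_def)
qed simp

text \<open>The two tails together form a submultiset of the union with as many entries as the tail
  on the left.\<close>

lemma union_tail_le:
  assumes "p \<le> length x" "r \<le> length u"
  shows "sum_list (drop (p + r) (union_seq u x)) \<le> sum_list (drop p x) + sum_list (drop r u)"
proof -
  let ?M = "mset (drop p x) + mset (drop r u)"
  have "mset (drop p x) \<subseteq># mset x" "mset (drop r u) \<subseteq># mset u"
    by (metis append_take_drop_id mset_append mset_subset_eq_add_right)+
  then have "?M \<subseteq># mset (union_seq u x)"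
    unfolding mset_union_seq by (metis subset_mset.add_mono union_commute)
  from sum_smallest_le[OF partition_union_seq this]
  show ?thesis using assms
    by (simp add: length_union_seq sum_mset_sum_list add.commute)
qed

text \<open>The hypotheses \<open>xu\<close> and \<open>ux\<close> say that the two cuts fit:
  nothing before one cut is smaller than anything after the other. So sorting the upper parts and
  the lower parts separately and concatenating them sorts the union.\<close>

lemma union_tail_eq:
  assumes px: "is_partition x" and pu: "is_partition u"
    and p: "p \<le> length x" and r: "r \<le> length u"
    and xu: "0 < p \<Longrightarrow> r < length u \<Longrightarrow> u ! r \<le> x ! (p - 1)"
    and ux: "0 < r \<Longrightarrow> p < length x \<Longrightarrow> x ! p \<le> u ! (r - 1)"
  shows "sum_list (drop (p + r) (union_seq u x)) = sum_list (drop p x) + sum_list (drop r u)"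
proof -
  define E1 where "E1 = union_seq (take r u) (take p x)"
  define E2 where "E2 = union_seq (drop r u) (drop p x)"
  have "z' \<le> z" if "z \<in> set E1" "z' \<in> set E2" for z z'
  proof -
    have "set E1 = set (take r u) \<union> set (take p x)"
      by (metis E1_def mset_union_seq set_mset_mset set_mset_union)
    moreover have "set E2 = set (drop r u) \<union> set (drop p x)"
      by (metis E2_def mset_union_seq set_mset_mset set_mset_union)
    moreover have "0 < r \<and> u ! (r - 1) \<le> y" if yt: "y \<in> set (take r u)" for y
    proof -
      obtain i where "i < r" "y = u ! i" using yt r by (auto simp: in_set_conv_nth)
      then show ?thesis using partition_nth_mono[OF pu, of i "r - 1"] r by auto
    qed
    moreover have "0 < p \<and> x ! (p - 1) \<le> y" if yt: "y \<in> set (take p x)" for y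
    proof -
      obtain i where "i < p" "y = x ! i" using yt p by (auto simp: in_set_conv_nth)
      then show ?thesis using partition_nth_mono[OF px, of i "p - 1"] p by auto
    qed
    moreover have "r < length u \<and> y \<le> u ! r" if yt: "y \<in> set (drop r u)" for y
    proof -
      obtain i where "i < length u - r" "y = u ! (r + i)" using yt by (auto simp: in_set_conv_nth)
      then show ?thesis using partition_nth_mono[OF pu, of r "r + i"] by auto
    qed
    moreover have "p < length x \<and> y \<le> x ! p" if yt: "y \<in> set (drop p x)" for y
    proof -
      obtain i where "i < length x - p" "y = x ! (p + i)" using yt by (auto simp: in_set_conv_nth)
      then show ?thesis using partition_nth_mono[OF px, of p "p + i"] by auto
    qed
    moreover have "0 < r \<Longrightarrow> r < length u \<Longrightarrow> u ! r \<le> u ! (r - 1)"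
      by (rule partition_nth_mono[OF pu]) auto
    moreover have "0 < p \<Longrightarrow> p < length x \<Longrightarrow> x ! p \<le> x ! (p - 1)"
      by (rule partition_nth_mono[OF px]) auto
    ultimately show ?thesis using that xu ux by (metis (no_types, lifting) UnE le_trans order_trans)
  qed
  then have "is_partition (E1 @ E2)"
    using partition_union_seq unfolding is_partition_def sorted_wrt_append E1_def E2_def by blast
  moreover have "mset (E1 @ E2) = mset (union_seq u x)"
  proof -
    have "mset (take r u) + mset (drop r u) = mset u" "mset (take p x) + mset (drop p x) = mset x"
      by (metis append_take_drop_id mset_append)+
    then show ?thesis unfolding E1_def E2_def by (simp add: mset_union_seq add_ac)
  qed
  ultimately have "union_seq u x = E1 @ E2"
    using partition_unique partition_union_seq by metis
  moreover have "length E1 = p + r"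
    using p r by (simp add: E1_def length_union_seq)
  ultimately have "drop (p + r) (union_seq u x) = E2" by simp
  moreover have "sum_list E2 = sum_list (drop p x) + sum_list (drop r u)"
    unfolding E2_def by (metis add.commute mset_union_seq sum_mset.union sum_mset_sum_list)
  ultimately show ?thesis by simp
qed

section \<open>The construction seen from one side\<close>

text \<open>For nonincreasing \<open>u\<close>: at least \<open>r\<close> entries of \<open>u\<close> are smaller than \<open>v\<close>.\<close>
definition below :: "int list \<Rightarrow> nat \<Rightarrow> int \<Rightarrow> bool" where
  "below u r v \<longleftrightarrow> r \<le> length u \<and> (0 < r \<longrightarrow> u ! (length u - r) < v)"

definition upto_val :: "int list \<Rightarrow> nat \<Rightarrow> int \<Rightarrow> bool" where
  "upto_val u r v \<longleftrightarrow> r \<le> length u \<and> (0 < r \<longrightarrow> u ! (length u - r) \<le> v)"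

text \<open>The rule for putting the entry \<open>d\<^sub>j\<close> (\<open>x = d\<close>, \<open>u = a\<close>, \<open>p = j - 1\<close>) outside \<open>\<Delta>\<close>, where \<open>r = s - q\<^sub>j\<close>;
  the first disjunct is (a), the second (b).\<close>
definition drops :: "int list \<Rightarrow> int list \<Rightarrow> nat \<Rightarrow> int list \<Rightarrow> bool" where
  "drops x u p G \<longleftrightarrow> (\<exists>r. length G + Suc p = length x + Suc r \<and>
     (\<not> below u (Suc r) (x ! p) \<or>
      sum_list (drop p x) + sum_list (drop (length u - r) u) \<le> sum_list G))"

definition cnt_less :: "int list \<Rightarrow> int \<Rightarrow> nat" where
  "cnt_less x v = length (filter (\<lambda>z. z < v) x)"

text \<open>Condition (i) for a tail of \<open>G\<close> with first entry \<open>v\<close>,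
  \<open>N\<close> entries and sum \<open>\<sigma>\<close>. The first alternative is the negation of
  \<open>t_y \<le> m_y\<close>: the entries not accounted for by smaller entries of \<open>x\<close>
  can be paid by entries of \<open>u\<close> up to \<open>v\<close>.\<close>

definition tail_cond :: "int list \<Rightarrow> int list \<Rightarrow> int \<Rightarrow> nat \<Rightarrow> int \<Rightarrow> bool" where
  "tail_cond x u v N \<sigma> \<longleftrightarrow> upto_val u (N - cnt_less x v) v \<or>
     N \<le> length x + length u \<and>
     sum_list (drop (length x + length u - N) (union_seq u x)) \<le> \<sigma>"

text \<open>The process as seen by one side: \<open>p\<close> entries of \<open>x\<close> are still
  unprocessed, and a value of the other sequence shows up only when it is selected, by whatever
  rule. Thus the same analysis serves \<open>(d, a)\<close> and \<open>(c, b)\<close>.\<close>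

inductive run :: "int list \<Rightarrow> int list \<Rightarrow> nat \<Rightarrow> int list \<Rightarrow> bool" for x u where
  init: "run x u (length x) []"
| keep: "run x u (Suc p) G \<Longrightarrow> (\<And>g. g \<in> set G \<Longrightarrow> g \<le> x ! p) \<Longrightarrow> \<not> drops x u p G \<Longrightarrow>
    run x u p (x ! p # G)"
| discard: "run x u (Suc p) G \<Longrightarrow> (\<And>g. g \<in> set G \<Longrightarrow> g \<le> x ! p) \<Longrightarrow> drops x u p G \<Longrightarrow>
    run x u p G"
| other: "run x u p G \<Longrightarrow> (\<And>g. g \<in> set G \<Longrightarrow> g \<le> v) \<Longrightarrow> v \<notin> set x \<Longrightarrow>
    (\<And>i. p \<le> i \<Longrightarrow> i < length x \<Longrightarrow> x ! i < v) \<Longrightarrow> (0 < p \<Longrightarrow> v < x ! (p - 1)) \<Longrightarrow>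
    run x u p (v # G)"

definition tail_conds :: "int list \<Rightarrow> int list \<Rightarrow> int list \<Rightarrow> bool" where
  "tail_conds x u G \<longleftrightarrow> (\<forall>pre v T. G = pre @ v # T \<longrightarrow> v \<notin> set x \<longrightarrow>
     tail_cond x u v (Suc (length T)) (v + sum_list T))"

text \<open>The inequality that \<open>wgmajI\<close> asks for when \<open>v\<close> is the entry of
  \<open>g\<close> at an insertion: \<open>Suc r\<close> entries of \<open>u\<close> remain from the
  inserted one on, and \<open>below u (Suc r) v\<close> says that the inserted one is smaller than
  \<open>v\<close>.\<close>

definition tails_paid :: "int list \<Rightarrow> int list \<Rightarrow> int list \<Rightarrow> bool" where
  "tails_paid x u G \<longleftrightarrow> (\<forall>pre v T r. G = pre @ v # T \<longrightarrow> length T = cnt_less x v + r \<longrightarrow>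
     below u (Suc r) v \<longrightarrow>
     sum_list (drop (length x - cnt_less x v) x) + sum_list (drop (length u - r) u) \<le> sum_list T)"

lemma tail_conds_Cons:
  "tail_conds x u (v # G) \<longleftrightarrow> tail_conds x u G \<and>
     (v \<notin> set x \<longrightarrow> tail_cond x u v (Suc (length G)) (v + sum_list G))"
  unfolding tail_conds_def by (auto simp: Cons_eq_append_conv)

lemma tails_paid_Cons:
  "tails_paid x u (v # G) \<longleftrightarrow> tails_paid x u G \<and>
     (\<forall>r. length G = cnt_less x v + r \<longrightarrow> below u (Suc r) v \<longrightarrow>
       sum_list (drop (length x - cnt_less x v) x) + sum_list (drop (length u - r) u) \<le> sum_list G)"
  unfolding tails_paid_def by (auto simp: Cons_eq_append_conv)

lemma cnt_less_eq:
  assumes "is_partition x" "p \<le> length x"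
    and "\<And>i. p \<le> i \<Longrightarrow> i < length x \<Longrightarrow> x ! i < v" "0 < p \<Longrightarrow> v \<le> x ! (p - 1)"
  shows "cnt_less x v = length x - p"
proof -
  have "filter (\<lambda>z. z < v) (take p x) = []"
  proof -
    have "v \<le> z" if z: "z \<in> set (take p x)" for z
    proof -
      obtain i where "i < p" "z = x ! i" using z assms(2) by (auto simp: in_set_conv_nth)
      then show ?thesis
        using partition_nth_mono[OF assms(1), of i "p - 1"] assms(2,4) by fastforce
    qed
    then show ?thesis by (fastforce simp: filter_empty_conv)
  qed
  moreover have "filter (\<lambda>z. z < v) (drop p x) = drop p x"
    using assms(3) by (auto simp: filter_id_conv in_set_conv_nth)
  ultimately show ?thesis
    unfolding cnt_less_def by (metis append_Nil append_take_drop_id filter_append length_drop)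
qed

section \<open>Invariants of a run and the padded solution\<close>

lemma sum_list_drop_le:
  fixes u :: "int list"
  assumes "q \<le> p" "p \<le> length u" "\<And>i. q \<le> i \<Longrightarrow> i < p \<Longrightarrow> u ! i \<le> v"
  shows "sum_list (drop q u) \<le> int (p - q) * v + sum_list (drop p u)"
  using sum_list_drop_nth[OF assms(1,2)] sum_bounded_above[of "{q..<p}" "\<lambda>i. u ! i" v] assms(3) by auto

lemma sum_list_drop_ge:
  fixes u :: "int list"
  assumes "q \<le> p" "p \<le> length u" "\<And>i. q \<le> i \<Longrightarrow> i < p \<Longrightarrow> v \<le> u ! i"
  shows "int (p - q) * v + sum_list (drop p u) \<le> sum_list (drop q u)"
  using sum_list_drop_nth[OF assms(1,2)] sum_bounded_below[of "{q..<p}" v "\<lambda>i. u ! i"] assms(3) by auto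

text \<open>The rule \<open>drops\<close> presupposes that \<open>G\<close> already has at least
  \<open>length x - p\<close> entries. So a discarded entry always faces an entry of
  \<open>G\<close>, which is no larger; a kept entry faces itself or something smaller. The last
  clause becomes condition (1) of the majorization.\<close>

lemma run_basic:
  assumes "run x u p G" "is_partition x"
  shows "p \<le> length x \<and> length x \<le> length G + p \<and> is_partition G \<and>
    (\<forall>g\<in>set G. \<forall>i<p. g \<le> x ! i) \<and>
    (\<forall>i. p \<le> i \<longrightarrow> i < length x \<longrightarrow> length x \<le> length G + i \<and> G ! (length G + i - length x) \<le> x ! i)"
  using assms
proof (induction rule: run.induct)
  case init
  then show ?case by (simp add: is_partition_def)
next
  case (keep p G)
  then have IH: "Suc p \<le> length x" "length x \<le> length G + Suc p" "is_partition G"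
    "\<And>i. Suc p \<le> i \<Longrightarrow> i < length x \<Longrightarrow> length x \<le> length G + i \<and> G ! (length G + i - length x) \<le> x ! i"
    by auto
  have mono: "x ! p \<le> x ! i" if "i \<le> p" for i
    using partition_nth_mono[OF keep.prems that] IH by simp
  have "(x ! p # G) ! (length (x ! p # G) + i - length x) \<le> x ! i" if i: "p \<le> i" "i < length x" for i
  proof (cases "i = p")
    case True
    have "(x ! p # G) ! k \<le> x ! p" if "k \<le> length G" for k
      using keep.hyps(2) that by (cases k) auto
    then show ?thesis using True IH(1) i by (simp del: length_Cons)
  next
    case False
    then have *: "length x \<le> length G + i" "G ! (length G + i - length x) \<le> x ! i" using IH(4)[of i] i by auto
    then have "length (x ! p # G) + i - length x = Suc (length G + i - length x)" by simp
    then show ?thesis using * by (metis nth_Cons_Suc)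
  qed
  moreover have "is_partition (x ! p # G)"
    using IH(3) keep.hyps(2) by (auto simp: is_partition_def)
  moreover have "\<forall>g\<in>set (x ! p # G). \<forall>i<p. g \<le> x ! i"
  proof (intro ballI allI impI)
    fix g i assume g: "g \<in> set (x ! p # G)" and i: "i < p"
    have "g \<le> x ! p" using g keep.hyps(2) by auto
    also have "\<dots> \<le> x ! i" using mono i by simp
    finally show "g \<le> x ! i" .
  qed
  ultimately show ?case using IH(1,2) by auto
next
  case (discard p G)
  then have IH: "Suc p \<le> length x" "length x \<le> length G + Suc p" "is_partition G"
    "\<forall>g\<in>set G. \<forall>i<Suc p. g \<le> x ! i"
    "\<And>i. Suc p \<le> i \<Longrightarrow> i < length x \<Longrightarrow> length x \<le> length G + i \<and> G ! (length G + i - length x) \<le> x ! i"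
    by auto
  have le: "length x \<le> length G + p"
    using discard.hyps(3) by (auto simp: drops_def)
  have "length x \<le> length G + i \<and> G ! (length G + i - length x) \<le> x ! i" if i: "p \<le> i" "i < length x" for i
  proof (cases "i = p")
    case True
    have "length G + p - length x < length G" using le IH(1) by linarith
    then show ?thesis using True le discard.hyps(2) by simp
  next
    case False
    then show ?thesis using IH(5)[of i] i by simp
  qed
  then show ?case using IH le by auto
next
  case (other p G v)
  then have IH: "p \<le> length x" "length x \<le> length G + p" "is_partition G"
    "\<And>i. p \<le> i \<Longrightarrow> i < length x \<Longrightarrow> length x \<le> length G + i \<and> G ! (length G + i - length x) \<le> x ! i"
    "\<forall>g\<in>set G. \<forall>i<p. g \<le> x ! i"
    by auto
  have "length x \<le> length (v # G) + i \<and> (v # G) ! (length (v # G) + i - length x) \<le> x ! i"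
    if i: "p \<le> i" "i < length x" for i
  proof -
    have *: "length x \<le> length G + i" "G ! (length G + i - length x) \<le> x ! i" using IH(4)[of i] i by auto
    then have "length (v # G) + i - length x = Suc (length G + i - length x)" by simp
    then show ?thesis using * by (metis nth_Cons_Suc le_SucI length_Cons add_Suc)
  qed
  moreover have "is_partition (v # G)"
    using IH(3) other.hyps(2) by (auto simp: is_partition_def)
  moreover have "v \<le> x ! i" if "i < p" for i
    using partition_nth_mono[OF other.prems, of i "p - 1"] other.hyps(5) that IH(1) by force
  ultimately show ?case using IH(1,2,5) by auto
qed

text \<open>Here \<open>r\<close> is the surplus of \<open>G\<close> over the processed entries of
  \<open>x\<close>, to be paid by the \<open>r\<close> smallest entries of \<open>u\<close>. The
  bound is claimed when these do not exceed the next unprocessed entry of \<open>x\<close>; at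
  \<open>p = 0\<close> there is no such entry, and the bound is the final sum inequality.\<close>

definition slack :: "int list \<Rightarrow> int list \<Rightarrow> nat \<Rightarrow> int list \<Rightarrow> bool" where
  "slack x u p G \<longleftrightarrow> (\<forall>r. length G + p = length x + r \<longrightarrow> r \<le> length u \<longrightarrow>
     (0 < p \<longrightarrow> upto_val u r (x ! (p - 1))) \<longrightarrow>
     sum_list (drop p x) + sum_list (drop (length u - r) u) \<le> sum_list G)"

text \<open>The counterpart of \<open>slack\<close>: when the surplus cannot be paid by entries of
  \<open>u\<close> strictly below the next entry of \<open>x\<close>, the list \<open>G\<close> is
  compared with the smallest entries of the union. With \<open><\<close> here and
  \<open>\<le>\<close> there, both claims apply at equality.\<close>

definition tight :: "int list \<Rightarrow> int list \<Rightarrow> nat \<Rightarrow> int list \<Rightarrow> bool" where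
  "tight x u p G \<longleftrightarrow> (\<forall>r. length G + p = length x + r \<longrightarrow>
     \<not> (r \<le> length u \<and> (0 < p \<longrightarrow> below u r (x ! (p - 1)))) \<longrightarrow>
     length G \<le> length x + length u \<and>
     sum_list (drop (length x + length u - length G) (union_seq u x)) \<le> sum_list G)"

lemma below_mono: "below u r v \<Longrightarrow> v \<le> w \<Longrightarrow> below u r w"
  by (auto simp: below_def)

lemma below_upto: "below u r v \<Longrightarrow> upto_val u r v"
  by (auto simp: below_def upto_val_def)

lemma below_less:
  assumes "is_partition u" "below u r v" "r' \<le> r"
  shows "below u r' v"
proof -
  have "u ! (length u - r') \<le> u ! (length u - r)" if "0 < r'"
    using assms that by (intro partition_nth_mono) (auto simp: below_def)
  then show ?thesis using assms by (fastforce simp: below_def)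
qed

lemma upto_less:
  assumes "is_partition u" "upto_val u r v" "r' \<le> r"
  shows "upto_val u r' v"
proof -
  have "u ! (length u - r') \<le> u ! (length u - r)" if "0 < r'"
    using assms that by (intro partition_nth_mono) (auto simp: upto_val_def)
  then show ?thesis using assms by (fastforce simp: upto_val_def)
qed

context
  fixes x u :: "int list"
  assumes px: "is_partition x" and pu: "is_partition u"
begin

lemma keep_below:
  assumes "\<not> drops x u p G" "length G + Suc p = length x + r"
  shows "below u r (x ! p)"
proof (cases r)
  case 0
  then show ?thesis by (simp add: below_def)
next
  case (Suc r')
  then show ?thesis using assms by (auto simp: drops_def)
qed

text \<open>Vacuous: an entry is kept only if the surplus can be paid by entries of \<open>u\<close>
  below it, and the next entry of \<open>x\<close> is no smaller.\<close>

lemma tight_keep: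
  assumes "\<not> drops x u p G" "p < length x"
  shows "tight x u p (x ! p # G)"
  unfolding tight_def
proof (intro allI impI)
  fix r
  assume r: "length (x ! p # G) + p = length x + r"
    and nb: "\<not> (r \<le> length u \<and> (0 < p \<longrightarrow> below u r (x ! (p - 1))))"
  have "below u r (x ! p)" using keep_below[OF assms(1)] r by simp
  moreover have "x ! p \<le> x ! (p - 1)" by (rule partition_nth_mono[OF px]) (use assms in auto)
  ultimately have False using nb below_mono by (auto simp: below_def)
  then show "length (x ! p # G) \<le> length x + length u \<and>
     sum_list (drop (length x + length u - length (x ! p # G)) (union_seq u x)) \<le> sum_list (x ! p # G)" ..
qed

lemma slack_keep:
  assumes "\<not> drops x u p G" "p < length x" "slack x u (Suc p) G"
    and r: "length G + Suc p = length x + r"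
  shows "sum_list (drop (Suc p) x) + sum_list (drop (length u - r) u) \<le> sum_list G"
proof -
  have "below u r (x ! p)" using keep_below[OF assms(1) r] .
  then show ?thesis
    using assms(3) r below_upto unfolding slack_def by (auto simp: below_def)
qed

lemma slack_keep':
  assumes "\<not> drops x u p G" "p < length x" "slack x u (Suc p) G"
  shows "slack x u p (x ! p # G)"
  unfolding slack_def
  using slack_keep[OF assms] sum_list_drop_Suc[OF assms(2)] by auto

text \<open>The work lies in ties. Processed entries of \<open>x\<close> equal to
  \<open>x ! p\<close> are not counted by \<open>cnt_less\<close>, so as many further entries of
  \<open>u\<close> take their place; these are smaller than \<open>x ! p\<close>, and the exchange
  lowers the amount to be paid.\<close>

lemma paid_keep:
  assumes nd: "\<not> drops x u p G" and p: "p < length x" and sl: "slack x u (Suc p) G"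
    and hall: "length x \<le> length G + Suc p" and paid: "tails_paid x u G"
  shows "tails_paid x u (x ! p # G)"
  unfolding tails_paid_Cons
proof (intro conjI allI impI)
  fix r
  define v where "v = x ! p"
  define c where "c = cnt_less x (x ! p)"
  assume r: "length G = cnt_less x (x ! p) + r" and b: "below u (Suc r) (x ! p)"
  \<comment> \<open>The end of the block of entries equal to \<open>v\<close> that starts at
    \<open>p\<close>.\<close>
  define q where "q = (LEAST q. p \<le> q \<and> (q < length x \<longrightarrow> x ! q < v))"
  have qex: "p \<le> length x \<and> (length x < length x \<longrightarrow> x ! length x < v)" using p by simp
  have q: "p \<le> q" "q < length x \<Longrightarrow> x ! q < v" "q \<le> length x"
    using LeastI[of "\<lambda>q. p \<le> q \<and> (q < length x \<longrightarrow> x ! q < v)", OF qex]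
      Least_le[of "\<lambda>q. p \<le> q \<and> (q < length x \<longrightarrow> x ! q < v)", OF qex] unfolding q_def by auto
  have pq: "p < q" using q p by (metis le_neq_implies_less order_less_irrefl v_def)
  have ge: "v \<le> x ! i" if "p \<le> i" "i < q" for i
    using not_less_Least[of i "\<lambda>q. p \<le> q \<and> (q < length x \<longrightarrow> x ! q < v)"] that unfolding q_def[symmetric]
    by auto
  have eq: "x ! i = v" if "p \<le> i" "i < q" for i
    using ge[OF that] partition_nth_mono[OF px that(1)] that q(3) unfolding v_def by fastforce
  have c: "c = length x - q"
    unfolding c_def
  proof (rule cnt_less_eq[OF px q(3)])
    show "x ! i < x ! p" if "q \<le> i" "i < length x" for i
      using partition_nth_mono[OF px that] q(2) that unfolding v_def by fastforce
    show "x ! p \<le> x ! (q - 1)" using ge[of "q - 1"] pq unfolding v_def by auto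
  qed
  obtain al where al: "length G + Suc p = length x + al"
    using hall by (metis le_add_diff_inverse)
  have rr: "r = al + (q - Suc p)"
    using r al c q pq unfolding c_def[symmetric] by linarith
  have rs: "Suc r \<le> length u" using b by (simp add: below_def)
  have "u ! i < v" if "length u - Suc r \<le> i" "i < length u" for i
    using b partition_nth_mono[OF pu that] unfolding v_def below_def by auto
  then have "sum_list (drop (length u - r) u) \<le> int (length u - al - (length u - r)) * v + sum_list (drop (length u - al) u)"
    using rr rs by (intro sum_list_drop_le) (auto intro: less_imp_le)
  also have "length u - al - (length u - r) = q - Suc p"
    using rr rs by linarith
  finally have 1: "sum_list (drop (length u - r) u) \<le> int (q - Suc p) * v + sum_list (drop (length u - al) u)" .
  have 2: "int (q - Suc p) * v + sum_list (drop q x) \<le> sum_list (drop (Suc p) x)"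
    using pq q(3) ge by (intro sum_list_drop_ge) auto
  have "sum_list (drop (Suc p) x) + sum_list (drop (length u - al) u) \<le> sum_list G"
    by (rule slack_keep[OF nd p sl al])
  moreover have "length x - c = q" using c q(3) by simp
  ultimately show "sum_list (drop (length x - cnt_less x (x ! p)) x) + sum_list (drop (length u - r) u) \<le> sum_list G"
    using 1 2 unfolding c_def[symmetric] by simp
qed (rule paid)

text \<open>Discarding lowers the surplus from \<open>Suc r\<close> to \<open>r\<close>, and the
  next entry of \<open>x\<close> is no smaller than \<open>x ! p\<close>. So if the surplus cannot
  be paid afterwards, it could not be paid before.\<close>

lemma tight_discard:
  assumes "drops x u p G" "p < length x" "tight x u (Suc p) G"
  shows "tight x u p G"
  unfolding tight_def
proof (intro allI impI)
  fix r
  assume r: "length G + p = length x + r"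
    and nb: "\<not> (r \<le> length u \<and> (0 < p \<longrightarrow> below u r (x ! (p - 1))))"
  have "\<not> below u (Suc r) (x ! p)"
  proof
    assume b: "below u (Suc r) (x ! p)"
    then have "below u r (x ! p)" using below_less[OF pu] by simp
    moreover have "x ! p \<le> x ! (p - 1)" by (rule partition_nth_mono[OF px]) (use assms in auto)
    ultimately show False using nb below_mono by (auto simp: below_def)
  qed
  then show "length G \<le> length x + length u \<and>
     sum_list (drop (length x + length u - length G) (union_seq u x)) \<le> sum_list G"
    using assms(3) r unfolding tight_def by auto
qed

text \<open>If \<open>Suc r\<close> entries of \<open>u\<close> are below \<open>x ! p\<close>, the
  discard came from (b), which is the claim. Otherwise \<open>tight\<close> bounds \<open>G\<close>
  by the union, and the tail of the union splits exactly into the tails of \<open>x\<close> and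
  \<open>u\<close>.\<close>

lemma slack_discard:
  assumes dr: "drops x u p G" and p: "p < length x" and ti: "tight x u (Suc p) G"
  shows "slack x u p G"
  unfolding slack_def
proof (intro allI impI)
  fix r
  assume r: "length G + p = length x + r" and rs: "r \<le> length u"
    and up: "0 < p \<longrightarrow> upto_val u r (x ! (p - 1))"
  show "sum_list (drop p x) + sum_list (drop (length u - r) u) \<le> sum_list G"
  proof (cases "below u (Suc r) (x ! p)")
    case True
    then show ?thesis using dr r unfolding drops_def by auto
  next
    case False
    then have len: "length G \<le> length x + length u"
      and le: "sum_list (drop (length x + length u - length G) (union_seq u x)) \<le> sum_list G"
      using ti r unfolding tight_def by auto
    have "sum_list (drop (p + (length u - r)) (union_seq u x)) = sum_list (drop p x) + sum_list (drop (length u - r) u)"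
    proof (rule union_tail_eq[OF px pu])
      show "u ! (length u - r) \<le> x ! (p - 1)" if "0 < p" "length u - r < length u"
        using up that by (auto simp: upto_val_def)
      show "x ! p \<le> u ! (length u - r - 1)" if "0 < length u - r" "p < length x"
        using False that by (auto simp: below_def)
    qed (use p in auto)
    moreover have "p + (length u - r) = length x + length u - length G"
      using r rs by linarith
    ultimately show ?thesis using le by simp
  qed
qed

text \<open>The new entry \<open>v\<close> raises the surplus by one. If the additional entry of
  \<open>u\<close> is at most \<open>v\<close>, then \<open>v\<close> pays for it; otherwise
  \<open>cond\<close> compares with the union, whose tail splits at the cut because
  \<open>x ! p < v < u ! (length u - r)\<close>.\<close>

lemma other_step:
  assumes v: "\<And>i. p \<le> i \<Longrightarrow> i < length x \<Longrightarrow> x ! i < v" "0 < p \<Longrightarrow> v < x ! (p - 1)"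
    and p: "p \<le> length x" and hall: "length x \<le> length G + p"
    and cond: "tail_cond x u v (Suc (length G)) (v + sum_list G)"
    and sl: "slack x u p G" and paid: "tails_paid x u G"
  shows "slack x u p (v # G)" "tight x u p (v # G)" "tails_paid x u (v # G)"
proof -
  have cnt: "cnt_less x v = length x - p"
    using cnt_less_eq[OF px p v(1)] v(2) by fastforce
  obtain al where al: "length G + p = length x + al"
    using hall by (metis le_add_diff_inverse)
  have cond': "upto_val u (Suc al) v \<or> Suc (length G) \<le> length x + length u \<and>
     sum_list (drop (length x + length u - Suc (length G)) (union_seq u x)) \<le> v + sum_list G"
  proof -
    have "Suc (length G) - cnt_less x v = Suc al" using cnt al p by linarith
    then show ?thesis using cond unfolding tail_cond_def by simp
  qed
  show "tight x u p (v # G)"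
    unfolding tight_def
  proof (intro allI impI)
    fix r
    assume r: "length (v # G) + p = length x + r"
      and nb: "\<not> (r \<le> length u \<and> (0 < p \<longrightarrow> below u r (x ! (p - 1))))"
    then have "r = Suc al" using al by simp
    have "\<not> upto_val u (Suc al) v"
      using nb v(2) unfolding \<open>r = Suc al\<close> upto_val_def below_def by auto
    then show "length (v # G) \<le> length x + length u \<and>
      sum_list (drop (length x + length u - length (v # G)) (union_seq u x)) \<le> sum_list (v # G)"
      using cond' by simp
  qed
  show "slack x u p (v # G)"
    unfolding slack_def
  proof (intro allI impI)
    fix r
    assume r: "length (v # G) + p = length x + r" and rs: "r \<le> length u"
      and up: "0 < p \<longrightarrow> upto_val u r (x ! (p - 1))"
    have ral: "r = Suc al" using r al by simp
    show "sum_list (drop p x) + sum_list (drop (length u - r) u) \<le> sum_list (v # G)"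
    proof (cases "upto_val u r v")
      case True
      have "sum_list (drop p x) + sum_list (drop (length u - al) u) \<le> sum_list G"
        using sl al up upto_less[OF pu, of r _ al] ral rs unfolding slack_def by auto
      moreover have "sum_list (drop (length u - r) u) = u ! (length u - r) + sum_list (drop (length u - al) u)"
        using sum_list_drop_Suc[of "length u - r" u] rs unfolding ral by (simp add: Suc_diff_Suc)
      ultimately show ?thesis using True unfolding upto_val_def ral by auto
    next
      case False
      have "sum_list (drop (p + (length u - r)) (union_seq u x)) = sum_list (drop p x) + sum_list (drop (length u - r) u)"
      proof (rule union_tail_eq[OF px pu p])
        show "u ! (length u - r) \<le> x ! (p - 1)" if "0 < p" "length u - r < length u"
          using up that by (auto simp: upto_val_def)
        show "x ! p \<le> u ! (length u - r - 1)" if "0 < length u - r" "p < length x"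
        proof -
          have "x ! p < v" using v that by simp
          also have "v < u ! (length u - r)"
            using False rs ral by (auto simp: upto_val_def)
          also have "\<dots> \<le> u ! (length u - r - 1)"
            by (rule partition_nth_mono[OF pu]) (use ral rs in auto)
          finally show ?thesis by simp
        qed
      qed auto
      moreover have "p + (length u - r) = length x + length u - Suc (length G)"
        using r rs by simp
      ultimately show ?thesis using cond' False ral by simp
    qed
  qed
  show "tails_paid x u (v # G)"
    unfolding tails_paid_Cons
  proof (intro conjI allI impI)
    fix r
    assume r: "length G = cnt_less x v + r" and b: "below u (Suc r) v"
    then have ral: "r = al" using cnt al p by linarith
    have "upto_val u r (x ! (p - 1))" if "0 < p"
      using below_upto[OF below_mono[OF below_less[OF pu b]]] v(2)[OF that] by auto
    then have "sum_list (drop p x) + sum_list (drop (length u - r) u) \<le> sum_list G"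
      using sl al ral b unfolding slack_def by (auto simp: below_def)
    then show "sum_list (drop (length x - cnt_less x v) x) + sum_list (drop (length u - r) u) \<le> sum_list G"
      using cnt p by simp
  qed (rule paid)
qed

lemma run_invariants:
  assumes "run x u p G" "tail_conds x u G"
  shows "slack x u p G \<and> tight x u p G \<and> tails_paid x u G"
  using assms
proof (induction rule: run.induct)
  case init
  show ?case by (auto simp: slack_def tight_def tails_paid_def below_def)
next
  case (keep p G)
  then have IH: "slack x u (Suc p) G" "tails_paid x u G" by (auto simp: tail_conds_Cons)
  have p: "p < length x" "length x \<le> length G + Suc p"
    using run_basic[OF keep.hyps(1) px] by auto
  show ?case
    using tight_keep[OF keep.hyps(3) p(1)] slack_keep'[OF keep.hyps(3) p(1) IH(1)]
      paid_keep[OF keep.hyps(3) p(1) IH(1) p(2) IH(2)] by simp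
next
  case (discard p G)
  then have IH: "tight x u (Suc p) G" "tails_paid x u G" by auto
  have p: "p < length x" using run_basic[OF discard.hyps(1) px] by auto
  show ?case
    using tight_discard[OF discard.hyps(3) p IH(1)] slack_discard[OF discard.hyps(3) p IH(1)] IH(2)
    by simp
next
  case (other p G v)
  then have IH: "slack x u p G" "tails_paid x u G" by (auto simp: tail_conds_Cons)
  have p: "p \<le> length x" "length x \<le> length G + p"
    using run_basic[OF other.hyps(1) px] by auto
  have "tail_cond x u v (Suc (length G)) (v + sum_list G)"
    using other.prems other.hyps(3) by (simp add: tail_conds_Cons)
  from other_step[OF other.hyps(4,5) p this IH] show ?case by blast
qed

text \<open>The padding entries \<open>M\<close> pay for the larger entries of \<open>u\<close>.
  Inside the padding no entry of \<open>x\<close> can be matched, so position \<open>h\<close> takes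
  the \<open>h\<close>-th entry of \<open>u\<close>; inside \<open>G\<close>, the inequality at an
  insertion is \<open>tails_paid\<close>.\<close>

lemma run_feasible:
  assumes run: "run x u 0 G" and conds: "tail_conds x u G"
    and M: "\<And>z. z \<in> set x \<union> set u \<union> set G \<Longrightarrow> z < M"
  shows "length G \<le> length x + length u"
    and "is_partition (replicate (length x + length u - length G) M @ G)"
    and "wgmaj (replicate (length x + length u - length G) M @ G) x u"
proof -
  note basic = run_basic[OF run px]
  note inv = run_invariants[OF run conds]
  obtain al where al: "length G = length x + al"
    using basic by (metis add.right_neutral le_add_diff_inverse)
  \<comment> \<open>A larger surplus would trigger \<open>tight\<close> at \<open>p = 0\<close>,
    whose conclusion bounds the length of \<open>G\<close>.\<close>
  have als: "al \<le> length u"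
  proof (rule ccontr)
    assume "\<not> al \<le> length u"
    then have "length G \<le> length x + length u"
      using inv al unfolding tight_def by auto
    with \<open>\<not> al \<le> length u\<close> al show False by simp
  qed
  then show len: "length G \<le> length x + length u" using al by simp
  have fin: "sum_list x + sum_list (drop (length u - al) u) \<le> sum_list G"
    using inv al als unfolding slack_def by auto
  define N where "N = length u - al"
  have N: "length x + length u - length G = N" using al unfolding N_def by simp
  define g where "g = replicate N M @ G"
  have u_less: "u ! i < M" if "i < length u" for i using M that by auto
  have top: "sum_list x + sum_list (drop j u) \<le> sum_list (drop j g)" if j: "j \<le> N" for j
  proof -
    have "sum_list (drop j u) \<le> int (N - j) * M + sum_list (drop N u)"
      using j u_less by (intro sum_list_drop_le) (auto simp: N_def intro: less_imp_le)
    moreover have "sum_list (drop j g) = int (N - j) * M + sum_list G"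
      using j by (simp add: g_def sum_list_replicate)
    ultimately show ?thesis using fin unfolding N_def by simp
  qed
  have glen: "length g = length x + length u"
    using al als unfolding g_def N_def by simp
  have gG: "g ! i = G ! (i - N)" if "N \<le> i" for i
    using that by (simp add: g_def nth_append)
  have gM: "g ! i = M" if "i < N" for i
    using that by (simp add: g_def nth_append)
  have pg: "is_partition g"
  proof -
    have "sorted_wrt (\<ge>) (replicate N M)" by (induction N) auto
    moreover have "sorted_wrt (\<ge>) G" using basic by (simp add: is_partition_def)
    moreover have "z \<le> M" if "z \<in> set G" for z using M[of z] that by simp
    ultimately show ?thesis
      unfolding g_def is_partition_def by (simp add: sorted_wrt_append)
  qed
  then show "is_partition (replicate (length x + length u - length G) M @ G)"
    unfolding g_def N .
  have "wgmaj g x u"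
  proof (rule wgmajI[OF glen pg px])
    show "g ! (i + length u) \<le> x ! i" if "i < length x" for i
    proof -
      have "G ! (length G + i - length x) \<le> x ! i" using basic that by simp
      moreover have "length G + i - length x = i + length u - N" using al als unfolding N_def by simp
      ultimately show ?thesis using gG[of "i + length u"] unfolding N_def by simp
    qed
    show "sum_list x + sum_list u \<le> sum_list g" using top[of 0] by simp
  next
    fix h j
    assume j: "1 \<le> j" "j \<le> length u" "j \<le> h" and h: "h \<le> length x + j"
      and lt: "h - j < length x \<Longrightarrow> x ! (h - j) < g ! (h - 1)"
      and ge: "j < h \<Longrightarrow> g ! (h - 1) \<le> x ! (h - j - 1)" and a: "u ! (j - 1) < g ! (h - 1)"
    show "sum_list (drop (h - j) x) + sum_list (drop j u) \<le> sum_list (drop h g)"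
    proof (cases "h - 1 < N")
      case True
      have "\<not> j < h"
      proof
        assume "j < h"
        then have "M \<le> x ! (h - j - 1)" using ge gM[OF True] by simp
        moreover have "h - j - 1 < length x" using h j \<open>j < h\<close> by linarith
        ultimately show False using M[of "x ! (h - j - 1)"] by auto
      qed
      then show ?thesis using top[of j] True j by simp
    next
      case False
      define v where "v = g ! (h - 1)"
      define T where "T = drop h g"
      have hlen: "h - 1 < length g" using h j glen by linarith
      have "drop (h - 1) g = v # T"
        unfolding v_def T_def using Cons_nth_drop_Suc[OF hlen] j by simp
      moreover have "drop (h - 1) g = drop (h - 1 - N) G"
        using False by (simp add: g_def)
      ultimately have G: "G = take (h - 1 - N) G @ v # T"
        by (metis append_take_drop_id)
      \<comment> \<open>By \<open>lt\<close> and \<open>ge\<close>, the first \<open>h - j\<close>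
        entries of \<open>x\<close> are exactly those that are at least \<open>v\<close>.\<close>
      have cnt: "cnt_less x v = length x - (h - j)"
      proof (rule cnt_less_eq[OF px])
        show "h - j \<le> length x" using h by simp
        show "x ! i < v" if "h - j \<le> i" "i < length x" for i
          using partition_nth_mono[OF px that] lt that unfolding v_def by fastforce
        show "v \<le> x ! (h - j - 1)" if "0 < h - j" using ge that unfolding v_def by simp
      qed
      have "length T = cnt_less x v + (length u - j)"
        using cnt glen h j unfolding T_def by simp
      moreover have "below u (Suc (length u - j)) v"
        using a j unfolding below_def v_def by (auto simp: Suc_diff_le)
      ultimately have "sum_list (drop (length x - cnt_less x v) x) + sum_list (drop (length u - (length u - j)) u) \<le> sum_list T"
        using inv G unfolding tails_paid_def by blast
      then show ?thesis using cnt h j unfolding T_def by simp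
    qed
  qed
  then show "wgmaj (replicate (length x + length u - length G) M @ G) x u"
    unfolding g_def N .
qed

end

section \<open>Comparison with an arbitrary solution\<close>

definition dominated :: "int list \<Rightarrow> int list \<Rightarrow> bool" where
  "dominated g G \<longleftrightarrow> length G \<le> length g \<and> list_all2 (\<le>) (drop (length g - length G) g) G"

lemma dominated_Nil: "dominated g []"
  by (simp add: dominated_def)

lemma dominated_Cons:
  "dominated g (v # G) \<longleftrightarrow> dominated g G \<and> length G < length g \<and> g ! (length g - Suc (length G)) \<le> v"
proof (cases "length G < length g")
  case True
  then have "drop (length g - Suc (length G)) g
      = g ! (length g - Suc (length G)) # drop (length g - length G) g"
    by (metis Cons_nth_drop_Suc Suc_diff_Suc diff_less zero_less_Suc length_greater_0_conv list.size(3) not_less_zero)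
  then show ?thesis using True by (auto simp: dominated_def)
qed (auto simp: dominated_def)

lemma dominated_append: "dominated g (pre @ T) \<Longrightarrow> dominated g T"
  by (induction pre) (auto simp: dominated_Cons)

lemma dominated_sum:
  assumes "dominated g G"
  shows "sum_list (drop (length g - length G) g) \<le> sum_list G"
proof -
  have "list_all2 (\<le>) xs ys \<Longrightarrow> sum_list xs \<le> sum_list ys" for xs ys :: "int list"
    by (induction rule: list_all2_induct) auto
  then show ?thesis using assms by (auto simp: dominated_def)
qed

text \<open>Suppose \<open>g\<close> exceeds \<open>x ! p\<close> at the next position. Then the
  tail of \<open>g\<close> below it pays for the entries of \<open>x\<close> from some index at most
  \<open>p\<close> on and for the rest of \<open>u\<close>. After an exchange of entries this is the
  inequality of (b) for \<open>G\<close>, so \<open>x ! p\<close> would have been discarded.\<close>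

lemma dominated_keep:
  assumes px: "is_partition x" and pu: "is_partition u" and pg: "is_partition g"
    and len: "length g = length x + length u" and maj: "wgmaj g x u"
    and p: "p < length x" and hall: "length x \<le> length G + Suc p"
    and nd: "\<not> drops x u p G" and dom: "dominated g G"
  shows "dominated g (x ! p # G)"
proof (rule ccontr)
  assume "\<not> dominated g (x ! p # G)"
  then have not: "length G < length g \<Longrightarrow> x ! p < g ! (length g - Suc (length G))"
    using dom by (auto simp: dominated_Cons)
  define t where "t = length g - length G"
  have lenG: "length G \<le> length g" using dom by (simp add: dominated_def)
  obtain k where k: "k \<le> length u" "k \<le> t" "t - k \<le> length x"
    and tail: "sum_list (drop (t - k) x) + sum_list (drop k u) \<le> sum_list (drop t g)"
    and gt: "k < t \<Longrightarrow> g ! (t - 1) \<le> x ! (t - k - 1)"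
    using wgmaj_tail[OF len pg maj, of t] unfolding t_def by (metis diff_le_self)
  \<comment> \<open>Otherwise \<open>gt\<close> bounds \<open>g ! (t - 1)\<close> by an entry of
    \<open>x\<close> at index \<open>p\<close> or later, hence by \<open>x ! p\<close>.\<close>
  have tk: "t - k \<le> p"
  proof (rule ccontr)
    assume c: "\<not> t - k \<le> p"
    then have "g ! (t - 1) \<le> x ! (t - k - 1)" using gt by simp
    also have "\<dots> \<le> x ! p" by (rule partition_nth_mono[OF px]) (use c k in auto)
    also have "x ! p < g ! (t - 1)" using not c unfolding t_def by auto
    finally show False by simp
  qed
  obtain al where al: "length G + Suc p = length x + al"
    using hall by (metis le_add_diff_inverse)
  show False
  proof (cases al)
    case 0
    then show False using al tk k len lenG unfolding t_def by linarith
  next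
    case (Suc r)
    then have b: "below u (Suc r) (x ! p)"
      and lt: "sum_list G < sum_list (drop p x) + sum_list (drop (length u - r) u)"
      using nd al unfolding drops_def by auto
    have rs: "Suc r \<le> length u" using b by (simp add: below_def)
    \<comment> \<open>The exchange is one for one: entries of \<open>x\<close> from
      \<open>t - k\<close> up to \<open>p\<close>, each at least \<open>x ! p\<close>, against
      entries of \<open>u\<close> from \<open>length u - r\<close> up to \<open>k\<close>, each
      smaller than \<open>x ! p\<close>.\<close>
    have num: "p - (t - k) = k - (length u - r)" "length u - r \<le> k"
      using al Suc tk k len lenG rs unfolding t_def by linarith+
    have "int (p - (t - k)) * x ! p + sum_list (drop p x) \<le> sum_list (drop (t - k) x)"
      using tk p partition_nth_mono[OF px] by (intro sum_list_drop_ge) auto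
    moreover have "sum_list (drop (length u - r) u) \<le> int (k - (length u - r)) * x ! p + sum_list (drop k u)"
    proof (rule sum_list_drop_le[OF num(2) k(1)])
      fix i assume i: "length u - r \<le> i" "i < k"
      have "u ! i \<le> u ! (length u - Suc r)"
        by (rule partition_nth_mono[OF pu]) (use i k in auto)
      then show "u ! i \<le> x ! p" using b by (simp add: below_def)
    qed
    moreover have "sum_list (drop t g) \<le> sum_list G"
      using dominated_sum[OF dom] by (simp add: t_def)
    ultimately show False using tail lt num(1) by simp
  qed
qed

text \<open>A tail of \<open>g\<close> pays for a tail of \<open>x\<close> and a tail of
  \<open>u\<close>, hence for equally many smallest entries of the union, and \<open>G\<close>
  dominates \<open>g\<close>. This gives the second alternative of \<open>tail_cond\<close>.\<close>

lemma dominated_tail_conds: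
  assumes pg: "is_partition g" and len: "length g = length x + length u"
    and maj: "wgmaj g x u" and dom: "dominated g G"
  shows "tail_conds x u G"
  unfolding tail_conds_def
proof (intro allI impI)
  fix pre v T
  assume "G = pre @ v # T"
  then have dT: "dominated g (v # T)" using dom dominated_append by blast
  define t where "t = length g - Suc (length T)"
  have lenT: "Suc (length T) \<le> length g" using dT by (simp add: dominated_def)
  obtain k where k: "k \<le> length u" "k \<le> t" "t - k \<le> length x"
    and tail: "sum_list (drop (t - k) x) + sum_list (drop k u) \<le> sum_list (drop t g)"
    using wgmaj_tail[OF len pg maj, of t] unfolding t_def by (metis diff_le_self)
  have "sum_list (drop t (union_seq u x)) \<le> sum_list (drop (t - k) x) + sum_list (drop k u)"
    using union_tail_le[OF k(3,1)] k(2) by simp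
  also have "\<dots> \<le> sum_list (drop t g)" by (rule tail)
  also have "\<dots> \<le> v + sum_list T" using dominated_sum[OF dT] by (simp add: t_def)
  finally show "tail_cond x u v (Suc (length T)) (v + sum_list T)"
    using lenT len unfolding tail_cond_def t_def by simp
qed

section \<open>Counting indices by thresholds, and positions in the union\<close>

lemma below_eq_cnt:
  assumes "is_partition u"
  shows "below u r v \<longleftrightarrow> r \<le> cnt_less u v"
    and "{i. i < length u \<and> u ! i < v} = {length u - cnt_less u v..<length u}"
    and "cnt_less u v \<le> length u"
proof -
  let ?A = "{i. i < length u \<and> u ! i < v}"
  have card: "cnt_less u v = card ?A"
    unfolding cnt_less_def by (rule length_filter_conv_card)
  have up: "j \<in> ?A" if "i \<in> ?A" "i \<le> j" "j < length u" for i j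
    using partition_nth_mono[OF assms that(2,3)] that by auto
  have fin: "finite ?A" by simp
  show eq: "?A = {length u - cnt_less u v..<length u}"
  proof (cases "?A = {}")
    case True
    show ?thesis unfolding card True by simp
  next
    case False
    define l where "l = Min ?A"
    have l: "l \<in> ?A" unfolding l_def by (rule Min_in[OF fin False])
    have ge: "l \<le> i" if "i \<in> ?A" for i
      unfolding l_def by (rule Min_le[OF fin that])
    have A: "?A = {l..<length u}"
    proof (intro equalityI subsetI)
      show "i \<in> {l..<length u}" if "i \<in> ?A" for i using ge[OF that] that by simp
      show "i \<in> ?A" if "i \<in> {l..<length u}" for i using up[OF l, of i] that by simp
    qed
    have "l \<le> length u" using l by simp
    then show ?thesis unfolding card A by simp
  qed
  show le: "cnt_less u v \<le> length u" unfolding cnt_less_def by simp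
  show "below u r v \<longleftrightarrow> r \<le> cnt_less u v"
  proof (cases "0 < r \<and> r \<le> length u")
    case True
    then have "u ! (length u - r) < v \<longleftrightarrow> length u - r \<in> ?A" by auto
    also have "\<dots> \<longleftrightarrow> r \<le> cnt_less u v"
      unfolding eq using True le by auto
    finally show ?thesis using True by (simp add: below_def)
  qed (use le in \<open>auto simp: below_def\<close>)
qed

lemma upto_val_eq_below: "upto_val u r v = below u r (v + 1)"
  by (auto simp: upto_val_def below_def)

lemma less_indices:
  assumes "is_partition u"
  shows "{i\<in>{1..length u}. nth1 u i < v} = {length u - cnt_less u v + 1..length u}"
proof (intro set_eqI)
  fix i
  show "i \<in> {i\<in>{1..length u}. nth1 u i < v} \<longleftrightarrow> i \<in> {length u - cnt_less u v + 1..length u}"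
  proof (cases i)
    case (Suc k)
    have "k \<in> {i. i < length u \<and> u ! i < v} \<longleftrightarrow> k \<in> {length u - cnt_less u v..<length u}"
      unfolding below_eq_cnt(2)[OF assms] ..
    then show ?thesis by (auto simp: Suc nth1_def)
  qed simp
qed

lemma card_less_indices:
  "is_partition u \<Longrightarrow> card {i\<in>{1..length u}. nth1 u i < v} = cnt_less u v"
  using below_eq_cnt(3)[of u v] by (subst less_indices) auto

lemma card_greater_indices:
  assumes "is_partition u"
  shows "card {i\<in>{1..length u}. nth1 u i > v} = length u - cnt_less u (v + 1)"
proof -
  let ?A = "{i\<in>{1..length u}. nth1 u i < v + 1}"
  have "{i\<in>{1..length u}. nth1 u i > v} = {1..length u} - ?A"
    by auto
  moreover have "card ({1..length u} - ?A) = card {1..length u} - card ?A"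
    by (rule card_Diff_subset) auto
  ultimately show ?thesis
    using card_less_indices[OF assms, of "v + 1"] by simp
qed

lemma sum_drop_nth1:
  assumes "p \<le> length x"
  shows "sum_list (drop p x) = (\<Sum>i\<in>{p + 1..length x}. nth1 x i)"
proof -
  have "sum_list (drop p x) = (\<Sum>i=p..<length x. x ! i)"
    using sum_list_drop_nth[OF assms order_refl] by simp
  also have "\<dots> = (\<Sum>i\<in>{p + 1..length x}. nth1 x i)"
    by (rule sum.reindex_bij_witness[of _ "\<lambda>i. i - 1" Suc]) (auto simp: nth1_def)
  finally show ?thesis .
qed

text \<open>The right side counts the entries of the union from \<open>x_j\<close> on that exceed
  \<open>v\<close>. Equal entries of \<open>u\<close> stand before \<open>x_j\<close>, whence the
  strict inequality for \<open>u\<close>; among the entries of \<open>x\<close>, those from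
  \<open>x_j\<close> on are the ones with index at least \<open>j\<close>.\<close>

lemma among_smallest_iff:
  assumes px: "is_partition x" and j: "1 \<le> j" "j \<le> length x" and v: "v < nth1 x j"
  shows "among_smallest u x j v N \<longleftrightarrow>
    int (card {i\<in>{1..length u}. v < nth1 u i \<and> nth1 u i < nth1 x j}
      + card {i\<in>{j..length x}. v < nth1 x i}) \<le> N"
proof -
  define f where "f = (\<lambda>(v::int, t::nat, i::nat). (- v, t, i))"
  define T where "T = union_tags u x"
  define L where "L = length T"
  let ?U = "(\<lambda>i. (nth1 u i, 0::nat, i)) ` {1..length u}"
  let ?X = "(\<lambda>i. (nth1 x i, 1::nat, i)) ` {1..length x}"
  let ?l = "map (\<lambda>i. (u ! i, 0::nat, i + 1)) [0..<length u] @ map (\<lambda>i. (x ! i, 1::nat, i + 1)) [0..<length x]"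
  have T: "T = sort_key f ?l"
    by (simp add: T_def union_tags_def f_def)
  have setT: "set T = ?U \<union> ?X"
  proof -
    have "(\<lambda>i. (z ! i, k, i + 1)) ` {0..<length z} = (\<lambda>i. (nth1 z i, k, i)) ` {1..length z}"
      for z and k :: nat
    proof -
      have "{1..length z} = Suc ` {0..<length z}"
        unfolding image_Suc_atLeastLessThan by auto
      show ?thesis unfolding \<open>{1..length z} = Suc ` {0..<length z}\<close> image_image nth1_def by simp
    qed
    moreover have "set T = (\<lambda>i. (u ! i, 0::nat, i + 1)) ` {0..<length u} \<union> (\<lambda>i. (x ! i, 1::nat, i + 1)) ` {0..<length x}"
      by (simp add: T)
    ultimately show ?thesis by (simp only:)
  qed
  have injf: "inj f" by (auto simp: f_def inj_def)
  have distT: "distinct T"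
    unfolding T by (auto simp: distinct_map inj_on_def)
  have sorted: "sorted (map f T)" unfolding T by simp
  \<comment> \<open>The tags make all sort keys distinct, so positions are ordered exactly as
    keys.\<close>
  have le_iff: "f (T ! p) \<le> f (T ! p') \<longleftrightarrow> p \<le> p'" if "p < L" "p' < L" for p p'
  proof
    assume "p \<le> p'"
    then show "f (T ! p) \<le> f (T ! p')"
      using sorted_nth_mono[OF sorted, of p p'] that unfolding L_def by simp
  next
    assume le: "f (T ! p) \<le> f (T ! p')"
    show "p \<le> p'"
    proof (rule ccontr)
      assume "\<not> p \<le> p'"
      then have "f (T ! p') \<le> f (T ! p)"
        using sorted_nth_mono[OF sorted, of p' p] that unfolding L_def by simp
      then have "T ! p = T ! p'" using le injf by (simp add: inj_eq)
      then have "p = p'" using distT that unfolding L_def by (simp add: nth_eq_iff_index_eq)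
      then show False using \<open>\<not> p \<le> p'\<close> by simp
    qed
  qed
  let ?e = "(nth1 x j, 1::nat, j)"
  have eT: "?e \<in> set T" unfolding setT using j by auto
  then obtain p where p: "p < L" "T ! p = ?e" unfolding L_def by (auto simp: in_set_conv_nth)
  have uniq: "q = p" if "q < L" "snd (T ! q) = (1, j)" for q
  proof -
    have "T ! q \<in> set T" using that unfolding L_def by simp
    then have "T ! q = ?e" using that(2) unfolding setT by auto
    then show ?thesis using p that distT unfolding L_def by (metis nth_eq_iff_index_eq)
  qed
  let ?B = "{e\<in>set T. v < fst e \<and> f ?e \<le> f e}"
  have "bij_betw (\<lambda>q. T ! (q - 1)) {q\<in>{1..L}. v < fst (T ! (q - 1)) \<and> p + 1 \<le> q} ?B"
  proof (rule bij_betwI')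
    fix q q' assume "q \<in> {q\<in>{1..L}. v < fst (T ! (q - 1)) \<and> p + 1 \<le> q}"
      "q' \<in> {q\<in>{1..L}. v < fst (T ! (q - 1)) \<and> p + 1 \<le> q}"
    then show "T ! (q - 1) = T ! (q' - 1) \<longleftrightarrow> q = q'"
      using distT unfolding L_def by (auto simp: nth_eq_iff_index_eq)
  next
    fix q assume "q \<in> {q\<in>{1..L}. v < fst (T ! (q - 1)) \<and> p + 1 \<le> q}"
    then show "T ! (q - 1) \<in> ?B"
      using le_iff[of p "q - 1"] p by (auto simp: L_def)
  next
    fix e assume e: "e \<in> ?B"
    then obtain q where q: "q < L" "T ! q = e" unfolding L_def by (auto simp: in_set_conv_nth)
    then show "\<exists>q\<in>{q\<in>{1..L}. v < fst (T ! (q - 1)) \<and> p + 1 \<le> q}. e = T ! (q - 1)"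
      using le_iff[of p q] p e by (intro bexI[of _ "Suc q"]) auto
  qed
  then have card1: "card {q\<in>{1..L}. v < fst (T ! (q - 1)) \<and> p + 1 \<le> q} = card ?B"
    by (rule bij_betw_same_card)
  have B: "?B = (\<lambda>i. (nth1 u i, 0, i)) ` {i\<in>{1..length u}. v < nth1 u i \<and> nth1 u i < nth1 x j}
      \<union> (\<lambda>i. (nth1 x i, 1, i)) ` {i\<in>{j..length x}. v < nth1 x i}"
  proof -
    have "f ?e \<le> f (nth1 x i, 1, i) \<longleftrightarrow> j \<le> i" if "1 \<le> i" "i \<le> length x" for i
    proof -
      have "nth1 x i \<le> nth1 x j" if "j \<le> i"
        unfolding nth1_def using that j \<open>i \<le> length x\<close> by (intro partition_nth_mono[OF px]) auto
      moreover have "nth1 x j \<le> nth1 x i" if "i \<le> j"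
        unfolding nth1_def using that j \<open>1 \<le> i\<close> by (intro partition_nth_mono[OF px]) auto
      moreover have "f ?e \<le> f (nth1 x i, 1, i) \<longleftrightarrow> nth1 x i < nth1 x j \<or> nth1 x i = nth1 x j \<and> j \<le> i"
        by (auto simp: f_def less_eq_prod_def)
      ultimately show ?thesis by linarith
    qed
    moreover have "f ?e \<le> f (nth1 u i, 0, i) \<longleftrightarrow> nth1 u i < nth1 x j" for i
      by (auto simp: f_def less_eq_prod_def less_prod_def)
    ultimately show ?thesis unfolding setT using j by (auto simp: image_iff)
  qed
  have "card ?B = card {i\<in>{1..length u}. v < nth1 u i \<and> nth1 u i < nth1 x j} + card {i\<in>{j..length x}. v < nth1 x i}"
    unfolding B by (subst card_Un_disjoint) (auto simp: card_image inj_on_def)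
  moreover have "among_smallest u x j v N \<longleftrightarrow>
      int (card {q\<in>{1..L}. v < fst (T ! (q - 1)) \<and> p + 1 \<le> q}) \<le> N"
  proof
    assume "among_smallest u x j v N"
    then obtain q where q: "q \<in> {1..L}" "snd (T ! (q - 1)) = (1, j)"
      "int (card {p'\<in>{1..L}. fst (T ! (p' - 1)) > v \<and> p' \<ge> q}) \<le> N"
      unfolding among_smallest_def Let_def T_def[symmetric] L_def[symmetric] by blast
    have "q = p + 1" using uniq[of "q - 1"] q by auto
    then show "int (card {q\<in>{1..L}. v < fst (T ! (q - 1)) \<and> p + 1 \<le> q}) \<le> N" using q(3) by simp
  next
    assume "int (card {q\<in>{1..L}. v < fst (T ! (q - 1)) \<and> p + 1 \<le> q}) \<le> N"
    then show "among_smallest u x j v N"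
      unfolding among_smallest_def Let_def T_def[symmetric] L_def[symmetric]
      using p v by (intro bexI[of _ "p + 1"]) auto
  qed
  ultimately show ?thesis using card1 by simp
qed

section \<open>The selection process\<close>

text \<open>The data of a tail of \<open>G\<close> on which \<open>tail_cond\<close> depends: first
  value, length, sum.\<close>

definition entries :: "int list \<Rightarrow> int set \<Rightarrow> (int \<times> nat \<times> int) set" where
  "entries G Y = {(v, Suc (length T), v + sum_list T) |pre v T. G = pre @ v # T \<and> v \<in> Y}"

text \<open>The same triple read off from the index sets, as in (i): the tail starting at
  \<open>y_j\<close> consists of the selected \<open>y\<close>'s from index \<open>j\<close> on and
  the selected \<open>x\<close>'s below \<open>y_j\<close>.\<close>

definition entry :: "int list \<Rightarrow> int list \<Rightarrow> nat set \<Rightarrow> nat set \<Rightarrow> nat \<Rightarrow> int \<times> nat \<times> int" where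
  "entry x y I J j = (nth1 y j,
     card {j'\<in>J. j \<le> j'} + card {i\<in>I. nth1 x i < nth1 y j},
     (\<Sum>j'\<in>{j'\<in>J. j \<le> j'}. nth1 y j') + (\<Sum>i\<in>{i\<in>I. nth1 x i < nth1 y j}. nth1 x i))"

text \<open>The state of the construction seen from the side of \<open>x\<close>: \<open>I\<close> and \<open>J\<close> are the selected
  indices of \<open>x\<close> and \<open>y\<close>, \<open>p\<close> and \<open>py\<close> the numbers of unprocessed entries, and \<open>G\<close> lists
  the selected values. The clause about the least index \<open>j\<close> of \<open>J\<close> justifies the simplified
  form of (a) in \<open>drops\<close>: once an entry above the current \<open>c\<^sub>l\<close> has been selected,
  (a) fails for all further entries until the next \<open>c\<close> is selected.\<close>
definition side_inv where
  "side_inv x u y p py I J G \<longleftrightarrow>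
     run x u p G \<and> I \<subseteq> {p + 1..length x} \<and>
     (\<forall>i\<in>{p + 1..length x}. 0 < py \<longrightarrow> nth1 x i < nth1 y py) \<and>
     (\<forall>j\<in>J. \<forall>r. (\<forall>j'\<in>J. j \<le> j') \<longrightarrow> length G + p = length x + r \<longrightarrow> 0 < r \<longrightarrow> 0 < p \<longrightarrow>
        (\<exists>i\<in>I. nth1 y j < nth1 x i) \<longrightarrow> below u r (nth1 x p)) \<and>
     entries G (set y) = entry x y I J ` J"

definition state_inv where
  "state_inv x u y w p py I J G \<longleftrightarrow>
     side_inv x u y p py I J G \<and> side_inv y w x py p J I G \<and>
     length G = card I + card J \<and> set G \<subseteq> set x \<union> set y \<and>
     sum_list G = (\<Sum>i\<in>I. nth1 x i) + (\<Sum>j\<in>J. nth1 y j)"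

lemma state_inv_sym: "state_inv x u y w p py I J G \<longleftrightarrow> state_inv y w x u py p J I G"
  unfolding state_inv_def by (auto simp: add.commute Un_commute)

lemma entries_Cons:
  "entries (v # G) Y = (if v \<in> Y then {(v, Suc (length G), v + sum_list G)} else {}) \<union> entries G Y"
  unfolding entries_def by (auto simp: Cons_eq_append_conv)

lemma tail_conds_entries:
  assumes "set G \<subseteq> set x \<union> set y" "set x \<inter> set y = {}"
  shows "tail_conds x u G \<longleftrightarrow> (\<forall>(v, N, \<sigma>)\<in>entries G (set y). tail_cond x u v N \<sigma>)"
proof -
  have "v \<notin> set x \<longleftrightarrow> v \<in> set y" if "G = pre @ v # T" for pre v T
    using assms that by auto
  then show ?thesis unfolding tail_conds_def entries_def by fast
qed

section \<open>The selection rules and conditions (i), (ii) in terms of the list of selected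
  values\<close>

lemma nth1_mono:
  assumes "is_partition x" "1 \<le> i" "i \<le> j" "j \<le> length x"
  shows "nth1 x j \<le> nth1 x i"
  unfolding nth1_def by (rule partition_nth_mono) (use assms in auto)

lemma nth1_in_set: "1 \<le> i \<Longrightarrow> i \<le> length x \<Longrightarrow> nth1 x i \<in> set x"
  by (cases i) (auto simp: nth1_def)

text \<open>All selected \<open>y\<close>'s are smaller than the processed entry, so
  \<open>q_j = s - al + 1\<close> with \<open>al\<close> the surplus. Adding the selected entries of
  \<open>x\<close> to both sides turns (b) into the inequality of \<open>drops\<close>; (a) becomes
  a statement about \<open>u\<close> by counting.\<close>

lemma goes_in_iff:
  assumes px: "is_partition x" and pu: "is_partition u"
    and inv: "state_inv x u y w (Suc p) py I J G"
    and disj: "set x \<inter> set y = {}"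
    and ord: "\<And>j. j \<in> J \<Longrightarrow> nth1 y j < nth1 x (Suc p)"
  shows "goes_in x u y J ({Suc p + 1..length x} - I) (Suc p) \<longleftrightarrow> \<not> drops x u p G"
proof -
  let ?ND = "{Suc p + 1..length x} - I"
  have sx: "side_inv x u y (Suc p) py I J G" and sy: "side_inv y w x py (Suc p) J I G"
    and lenG: "length G = card I + card J"
    and sumG: "sum_list G = (\<Sum>i\<in>I. nth1 x i) + (\<Sum>j\<in>J. nth1 y j)"
    using inv by (auto simp: state_inv_def)
  have I: "I \<subseteq> {Suc p + 1..length x}" and J: "J \<subseteq> {py + 1..length y}"
    using sx sy by (auto simp: side_inv_def)
  have finI: "finite I" and finJ: "finite J" using I J finite_subset by blast+
  have basic: "Suc p \<le> length x" "length x \<le> length G + Suc p"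
    using run_basic[OF _ px, of u "Suc p" G] sx by (auto simp: side_inv_def)
  obtain al where al: "length G + Suc p = length x + al"
    using basic(2) by (metis le_add_diff_inverse)
  have cND: "card ?ND = length x - Suc p - card I"
    using card_Diff_subset[OF finI I] by simp
  have cI: "card I \<le> length x - Suc p" using card_mono[OF _ I] by simp
  have ND': "{i\<in>?ND. Suc p < i} = ?ND" by auto
  have J': "{j\<in>J. nth1 y j < nth1 x (Suc p)} = J" using ord by auto
  define q where "q = int (length u) - int (card J) + int (card ?ND) + 1"
  have q: "q = int (length u) - int al + 1"
    unfolding q_def cND using al lenG cI basic by linarith
  define l where "l = Min J"
  define N where "N = int (card {i\<in>{1..length u}. nth1 u i > nth1 y l}) - int (length u)
                   + int (card {i\<in>J. i > l}) - int (card {i\<in>?ND. nth1 x i < nth1 y l}) + 1"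
  have goes: "goes_in x u y J ?ND (Suc p) \<longleftrightarrow> q > int (length u) \<or>
      \<not> (N \<ge> 1 \<and> among_smallest u x (Suc p) (nth1 y l) N) \<and>
      \<not> (ereal (\<Sum>i\<in>J. nth1 y i) \<ge> ereal (\<Sum>i\<in>?ND. nth1 x i) + ereal (nth1 x (Suc p))
                       + esum u (q + 1) (int (length u)))"
    unfolding goes_in_def Let_def ND' J' q_def[symmetric] l_def[symmetric] N_def[symmetric] by simp
  show ?thesis
  proof (cases al)
    case 0
    then show ?thesis using al unfolding goes q drops_def by auto
  next
    case (Suc r)
    have "J \<noteq> {}" using al Suc lenG cI basic by auto
    have l: "l \<in> J" "\<And>j. j \<in> J \<Longrightarrow> l \<le> j"
      unfolding l_def using Min_in[OF finJ \<open>J \<noteq> {}\<close>] Min_le[OF finJ] by auto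
    define v where "v = nth1 x (Suc p)"
    define z where "z = nth1 y l"
    have zv: "z < v" using ord[OF l(1)] by (simp add: v_def z_def)
    have v: "x ! p = v" by (simp add: v_def nth1_def)
    have dr: "drops x u p G \<longleftrightarrow> \<not> below u (Suc r) v \<or>
        sum_list (drop p x) + sum_list (drop (length u - r) u) \<le> sum_list G"
      unfolding drops_def v using al Suc by auto
    have caseA: "(N \<ge> 1 \<and> among_smallest u x (Suc p) z N) \<longleftrightarrow> \<not> below u (Suc r) v"
    proof -
      define A where "A = card {i\<in>{1..length u}. z < nth1 u i \<and> nth1 u i < v}"
      define B where "B = card {i\<in>{Suc p..length x}. z < nth1 x i}"
      define C where "C = card {i\<in>I. z < nth1 x i}"
      define X where "X = card {i\<in>{Suc p..length x}. nth1 x i < z}"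
      have iff: "among_smallest u x (Suc p) z N \<longleftrightarrow> int (A + B) \<le> N"
        using among_smallest_iff[OF px, of "Suc p" z u N] basic zv unfolding A_def B_def v_def by simp
      \<comment> \<open>The processed entry itself is counted in \<open>B\<close>, so
        \<open>A + B \<le> N\<close> already yields \<open>N \<ge> 1\<close>.\<close>
      have B1: "1 \<le> B"
      proof -
        have "{Suc p} \<subseteq> {i\<in>{Suc p..length x}. z < nth1 x i}" using zv basic by (simp add: v_def)
        then have "card {Suc p} \<le> B" unfolding B_def by (intro card_mono) auto
        then show ?thesis by simp
      qed
      have A: "A + cnt_less u (z + 1) = cnt_less u v"
      proof -
        have "{i\<in>{1..length u}. nth1 u i < v} = {i\<in>{1..length u}. z < nth1 u i \<and> nth1 u i < v} \<union>
            {i\<in>{1..length u}. nth1 u i < z + 1}" using zv by auto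
        then have "card {i\<in>{1..length u}. nth1 u i < v} = A + card {i\<in>{1..length u}. nth1 u i < z + 1}"
          unfolding A_def by (subst card_Un_disjoint[symmetric]) auto
        then show ?thesis by (simp only: card_less_indices[OF pu])
      qed
      have zx: "nth1 x i \<noteq> z" if "i \<in> {Suc p..length x}" for i
      proof -
        have "nth1 x i \<in> set x" using that by (intro nth1_in_set) auto
        moreover have "z \<in> set y" unfolding z_def using l(1) J by (intro nth1_in_set) auto
        ultimately show ?thesis using disj by auto
      qed
      define Y where "Y = card {i\<in>I. nth1 x i < z}"
      define Z where "Z = card {i\<in>?ND. nth1 x i < z}"
      have BX: "B + X = length x - p"
      proof -
        have "{Suc p..length x} = {i\<in>{Suc p..length x}. z < nth1 x i} \<union> {i\<in>{Suc p..length x}. nth1 x i < z}"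
          using zx by force
        then have "card {Suc p..length x} =
            card ({i\<in>{Suc p..length x}. z < nth1 x i} \<union> {i\<in>{Suc p..length x}. nth1 x i < z})"
          by (rule arg_cong)
        also have "\<dots> = B + X"
          unfolding B_def X_def by (rule card_Un_disjoint) auto
        finally show ?thesis by simp
      qed
      have XYZ: "X = Y + Z"
      proof -
        have "{i\<in>{Suc p..length x}. nth1 x i < z} = {i\<in>I. nth1 x i < z} \<union> {i\<in>?ND. nth1 x i < z}"
        proof (intro equalityI subsetI)
          fix i assume i: "i \<in> {i\<in>{Suc p..length x}. nth1 x i < z}"
          then have "i \<noteq> Suc p" using zv unfolding v_def by auto
          then show "i \<in> {i\<in>I. nth1 x i < z} \<union> {i\<in>?ND. nth1 x i < z}" using i by auto
        qed (use I in auto)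
        then show ?thesis
          unfolding X_def Y_def Z_def using finI by (simp only:) (subst card_Un_disjoint; auto)
      qed
      have CY: "C + Y = card I"
      proof -
        have "I = {i\<in>I. z < nth1 x i} \<union> {i\<in>I. nth1 x i < z}"
        proof -
          have "z < nth1 x i \<or> nth1 x i < z" if "i \<in> I" for i
          proof -
            have "i \<in> {Suc p..length x}" using that I by auto
            then show ?thesis using zx[of i] by linarith
          qed
          then show ?thesis by blast
        qed
        then have "card I = card ({i\<in>I. z < nth1 x i} \<union> {i\<in>I. nth1 x i < z})" by simp
        also have "\<dots> = C + Y"
          unfolding C_def Y_def using finI by (subst card_Un_disjoint) auto
        finally show ?thesis by simp
      qed
      have "card {i\<in>J. l < i} = card J - 1"
      proof -
        have "{i\<in>J. l < i} = J - {l}" using l(2) by (auto simp: order_le_less)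
        then show ?thesis using l(1) by simp
      qed
      moreover have "1 \<le> card J" using \<open>J \<noteq> {}\<close> finJ by (simp add: Suc_leI card_gt_0_iff)
      ultimately have N: "N = int (card J) - int (cnt_less u (z + 1)) - int Z"
        unfolding N_def z_def[symmetric] Z_def[symmetric] card_greater_indices[OF pu]
        using below_eq_cnt(3)[OF pu, of "z + 1"] by simp
      \<comment> \<open>Here \<open>C\<close> is the number of selected entries of \<open>x\<close>
        above \<open>z\<close>; it is all that separates (a) from a pure threshold condition on
        \<open>u\<close>.\<close>
      have key: "int (A + B) \<le> N \<longleftrightarrow> cnt_less u v + C \<le> r"
        using N A BX XYZ CY lenG al Suc basic(1) by linarith
      \<comment> \<open>The clause of \<open>side_inv\<close> on the least index of
        \<open>J\<close>: a selected entry above \<open>z\<close> forces \<open>Suc r\<close>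
        entries of \<open>u\<close> below \<open>v\<close>.\<close>
      have "C = 0" if "Suc r > cnt_less u v"
      proof (rule ccontr)
        assume "C \<noteq> 0"
        then obtain i where "i \<in> I" "z < nth1 x i"
          unfolding C_def by (metis (mono_tags, lifting) card.empty empty_Collect_eq)
        then have "below u al v"
          using sx l al Suc unfolding side_inv_def v_def z_def by blast
        then show False using that below_eq_cnt(1)[OF pu] Suc by simp
      qed
      then have "int (A + B) \<le> N \<longleftrightarrow> \<not> below u (Suc r) v"
        unfolding key below_eq_cnt(1)[OF pu] by auto
      then show ?thesis using iff B1 by auto
    qed
    have caseB: "ereal (\<Sum>i\<in>J. nth1 y i) \<ge> ereal (\<Sum>i\<in>?ND. nth1 x i) + ereal (nth1 x (Suc p))
          + esum u (q + 1) (int (length u)) \<longleftrightarrow>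
        sum_list (drop p x) + sum_list (drop (length u - r) u) \<le> sum_list G"
      if "below u (Suc r) v"
    proof -
      have "esum u (q + 1) (int (length u)) = ereal (sum_list (drop (length u - r) u))"
        using that unfolding q Suc below_def by (intro esum_tail) auto
      moreover have "sum_list (drop p x) = nth1 x (Suc p) + (\<Sum>i\<in>?ND. nth1 x i) + (\<Sum>i\<in>I. nth1 x i)"
      proof -
        have "{p + 1..length x} = insert (Suc p) {Suc p + 1..length x}" using basic by auto
        then have "sum_list (drop p x) = nth1 x (Suc p) + (\<Sum>i\<in>{Suc p + 1..length x}. nth1 x i)"
          using sum_drop_nth1[of p x] basic by simp
        also have "(\<Sum>i\<in>{Suc p + 1..length x}. nth1 x i) = (\<Sum>i\<in>?ND. nth1 x i) + (\<Sum>i\<in>I. nth1 x i)"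
          by (rule sum.subset_diff[OF I]) simp
        finally show ?thesis by simp
      qed
      ultimately show ?thesis using sumG by (simp flip: of_int_add of_int_sum) linarith
    qed
    have "\<not> q > int (length u)" using q Suc by simp
    then show ?thesis
      unfolding goes z_def[symmetric] caseA dr using caseB by blast
  qed
qed

text \<open>A discard changes nothing for the side of \<open>y\<close>; a selection is
  \<open>keep\<close> for \<open>x\<close> and \<open>other\<close> for \<open>y\<close>. The clause
  on the least index of \<open>J\<close> survives a discard because the surplus shrinks, and after a
  selection it follows from \<open>keep_below\<close>.\<close>

lemma state_inv_step:
  assumes px: "is_partition x" and py: "is_partition y" and pu: "is_partition u"
    and disj: "set x \<inter> set y = {}"
    and inv: "state_inv x u y w (Suc p) q I J G"
    and less: "0 < q \<Longrightarrow> nth1 x (Suc p) < nth1 y q"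
  shows "drops x u p G \<Longrightarrow> state_inv x u y w p q I J G"
    and "\<not> drops x u p G \<Longrightarrow> state_inv x u y w p q (insert (Suc p) I) J (nth1 x (Suc p) # G)"
proof -
  define v where "v = nth1 x (Suc p)"
  have v: "x ! p = v" by (simp add: v_def nth1_def)
  have sx: "side_inv x u y (Suc p) q I J G" and sy: "side_inv y w x q (Suc p) J I G"
    and lenG: "length G = card I + card J" and setG: "set G \<subseteq> set x \<union> set y"
    and sumG: "sum_list G = (\<Sum>i\<in>I. nth1 x i) + (\<Sum>j\<in>J. nth1 y j)"
    using inv by (auto simp: state_inv_def)
  have rx: "run x u (Suc p) G" and I: "I \<subseteq> {Suc p + 1..length x}"
    and ordx: "\<forall>i\<in>{Suc p + 1..length x}. 0 < q \<longrightarrow> nth1 x i < nth1 y q"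
    and witx: "\<forall>j\<in>J. \<forall>r. (\<forall>j'\<in>J. j \<le> j') \<longrightarrow> length G + Suc p = length x + r \<longrightarrow> 0 < r \<longrightarrow>
        (\<exists>i\<in>I. nth1 y j < nth1 x i) \<longrightarrow> below u r v"
    and entx: "entries G (set y) = entry x y I J ` J"
    using sx by (auto simp: side_inv_def v_def)
  have ry: "run y w q G" and J: "J \<subseteq> {q + 1..length y}"
    and ordy: "\<And>j. j \<in> {q + 1..length y} \<Longrightarrow> nth1 y j < v"
    and wity: "\<forall>i\<in>I. \<forall>r. (\<forall>i'\<in>I. i \<le> i') \<longrightarrow> length G + q = length y + r \<longrightarrow> 0 < r \<longrightarrow> 0 < q \<longrightarrow>
        (\<exists>j\<in>J. nth1 x i < nth1 y j) \<longrightarrow> below w r (nth1 y q)"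
    and enty: "entries G (set x) = entry y x J I ` I"
    using sy by (auto simp: side_inv_def v_def)
  have ordJ: "nth1 y j < v" if "j \<in> J" for j using ordy J that by blast
  have finI: "finite I" and finJ: "finite J" using I J finite_subset by blast+
  have p: "p < length x" and Gle: "\<And>g. g \<in> set G \<Longrightarrow> g \<le> x ! p"
    using run_basic[OF rx px] by auto
  have vmono: "v \<le> nth1 x p" if "0 < p"
    unfolding v_def using nth1_mono[OF px, of p "Suc p"] that p by simp
  have ordx': "\<forall>i\<in>{p + 1..length x}. 0 < q \<longrightarrow> nth1 x i < nth1 y q"
  proof (intro ballI impI)
    fix i assume "i \<in> {p + 1..length x}" "0 < q"
    then show "nth1 x i < nth1 y q" using ordx less by (cases "i = Suc p") auto
  qed
  have ordy': "\<forall>j\<in>{q + 1..length y}. 0 < p \<longrightarrow> nth1 y j < nth1 x p"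
    using ordy vmono by fastforce
  show "state_inv x u y w p q I J G" if dr: "drops x u p G"
  proof -
    have wit: "\<forall>j\<in>J. \<forall>r. (\<forall>j'\<in>J. j \<le> j') \<longrightarrow> length G + p = length x + r \<longrightarrow> 0 < r \<longrightarrow> 0 < p \<longrightarrow>
        (\<exists>i\<in>I. nth1 y j < nth1 x i) \<longrightarrow> below u r (nth1 x p)"
    proof (intro ballI allI impI)
      fix j r assume *: "j \<in> J" "\<forall>j'\<in>J. j \<le> j'" "length G + p = length x + r" "0 < r" "0 < p"
        "\<exists>i\<in>I. nth1 y j < nth1 x i"
      then have "length G + Suc p = length x + Suc r" by simp
      with * witx have "below u (Suc r) v" by blast
      then have "below u r v" using below_less[OF pu] by simp
      then show "below u r (nth1 x p)" using below_mono vmono * by blast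
    qed
    have "side_inv x u y p q I J G"
      unfolding side_inv_def using run.discard[OF rx Gle dr] I ordx' wit entx by auto
    moreover have "side_inv y w x q p J I G"
      unfolding side_inv_def using ry J ordy' wity enty by auto
    ultimately show ?thesis unfolding state_inv_def using lenG setG sumG by auto
  qed
  show "state_inv x u y w p q (insert (Suc p) I) J (nth1 x (Suc p) # G)" if nd: "\<not> drops x u p G"
  proof -
    let ?I = "insert (Suc p) I"
    have notI: "Suc p \<notin> I" using I by auto
    have vx: "v \<in> set x" using p v nth_mem by blast
    have vy: "v \<notin> set y" using vx disj by auto
    have wit: "\<forall>j\<in>J. \<forall>r. (\<forall>j'\<in>J. j \<le> j') \<longrightarrow> length (v # G) + p = length x + r \<longrightarrow> 0 < r \<longrightarrow> 0 < p \<longrightarrow>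
        (\<exists>i\<in>?I. nth1 y j < nth1 x i) \<longrightarrow> below u r (nth1 x p)"
    proof (intro ballI allI impI)
      fix j r assume *: "length (v # G) + p = length x + r" "0 < p"
      then have "below u r v" using keep_below[OF px pu nd, of r] v by simp
      then show "below u r (nth1 x p)" using below_mono vmono * by blast
    qed
    have ent: "entries (v # G) (set y) = entry x y ?I J ` J"
    proof -
      have "entry x y ?I J j = entry x y I J j" if "j \<in> J" for j
      proof -
        have "{i \<in> ?I. nth1 x i < nth1 y j} = {i \<in> I. nth1 x i < nth1 y j}"
          using ordJ[OF that] by (auto simp: v_def)
        then show ?thesis by (simp add: entry_def)
      qed
      then show ?thesis using entx vy by (simp add: entries_Cons)
    qed
    have "run x u p (v # G)" using run.keep[OF rx Gle nd] v by simp
    then have s1: "side_inv x u y p q ?I J (v # G)"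
      unfolding side_inv_def using I ordx' wit ent p by auto
    have ry': "run y w q (v # G)"
    proof (rule run.other[OF ry _ vy])
      show "g \<le> v" if "g \<in> set G" for g using Gle[OF that] v by simp
      show "y ! i < v" if "q \<le> i" "i < length y" for i
        using ordy[of "Suc i"] that by (simp add: nth1_def)
      show "v < y ! (q - 1)" if "0 < q" using less[OF that] by (simp add: v_def nth1_def)
    qed
    \<comment> \<open>The new index is the least one of \<open>?I\<close>, and its entry exceeds
      every selected \<open>y\<close>, so the premise on \<open>J\<close> fails.\<close>
    have wit': "\<forall>i\<in>?I. \<forall>r. (\<forall>i'\<in>?I. i \<le> i') \<longrightarrow> length (v # G) + q = length y + r \<longrightarrow> 0 < r \<longrightarrow> 0 < q \<longrightarrow>
        (\<exists>j\<in>J. nth1 x i < nth1 y j) \<longrightarrow> below w r (nth1 y q)"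
    proof (intro ballI allI impI)
      fix i r assume *: "i \<in> ?I" "\<forall>i'\<in>?I. i \<le> i'" "\<exists>j\<in>J. nth1 x i < nth1 y j"
      then have "i = Suc p" using I by fastforce
      then have False using * ordJ unfolding v_def by fastforce
      then show "below w r (nth1 y q)" ..
    qed
    \<comment> \<open>Triples of earlier indices stay the same; the new index contributes the triple
      of the whole list.\<close>
    have ent': "entries (v # G) (set x) = entry y x J ?I ` ?I"
    proof -
      have "entry y x J ?I i = entry y x J I i" if "i \<in> I" for i
      proof -
        have "{i' \<in> ?I. i \<le> i'} = {i' \<in> I. i \<le> i'}" using that I by fastforce
        then show ?thesis by (simp add: entry_def)
      qed
      moreover have "entry y x J ?I (Suc p) = (v, Suc (length G), v + sum_list G)"
      proof -
        have "{i' \<in> ?I. Suc p \<le> i'} = ?I" using I by fastforce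
        moreover have "{j \<in> J. nth1 y j < nth1 x (Suc p)} = J" using ordJ by (auto simp: v_def)
        ultimately show ?thesis
          using lenG sumG notI finI by (simp add: entry_def v_def)
      qed
      ultimately show ?thesis using enty vx by (simp add: entries_Cons)
    qed
    have s2: "side_inv y w x q p J ?I (v # G)"
      unfolding side_inv_def using ry' J ordy' wit' ent' by auto
    show ?thesis
      unfolding state_inv_def v_def[symmetric] using s1 s2 lenG setG sumG notI finI vx by (auto simp: v_def)
  qed
qed

text \<open>The left side of (i) is a block of the union. After its end \<open>z_y + m_y\<close>
  come exactly the entries of \<open>x\<close> and \<open>u\<close> that are at most
  \<open>c^y\<close>; adding their sum to both sides turns the block into a tail with
  \<open>N\<close> entries and the right side into \<open>\<sigma>\<close>.\<close>

lemma cond_side_iff: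
  assumes px: "is_partition x" and pu: "is_partition u"
    and disj: "set x \<inter> set y = {}"
    and I: "I \<subseteq> {1..length x}" and J: "J \<subseteq> {1..length y}"
  shows "cond_side y u x J I \<longleftrightarrow> (\<forall>(v, N, \<sigma>)\<in>entry x y I J ` J. tail_cond x u v N \<sigma>)"
proof -
  have finI: "finite I" and finJ: "finite J" using I J finite_subset by blast+
  define js where "js = sorted_list_of_set J"
  have js: "length js = card J" "set js = J" "sorted js" "distinct js"
    using finJ by (simp_all add: js_def)
  let ?h = "card J"
  let ?e = "union_seq u x"
  let ?ND = "{1..length x} - I"
  define cond where "cond w \<longleftrightarrow>
      (let cw = sub_elem y J w;
             mw = int (card {i\<in>{1..length u}. nth1 u i > cw});
             tw = int (length u) - (int ?h - int w) + int (card {i\<in>?ND. nth1 x i < cw});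
             zw = int (card {i\<in>{1..length x}. nth1 x i > cw})
         in tw \<le> mw \<longrightarrow>
            esum ?e (zw + tw) (zw + mw) \<le>
              ereal (\<Sum>i\<in>{w..?h}. sub_elem y J i)
              - ereal (\<Sum>i\<in>{i\<in>?ND. int i \<ge> zw + 1}. nth1 x i)
              - esum u (mw + 1) (int (length u)))" for w
  have cs: "cond_side y u x J I \<longleftrightarrow> (\<forall>w\<in>{1..?h}. cond w)"
    unfolding cond_side_def cond_def Let_def by simp
  have cond: "cond w \<longleftrightarrow> (case entry x y I J (js ! (w - 1)) of (v, N, \<sigma>) \<Rightarrow> tail_cond x u v N \<sigma>)"
    if w: "w \<in> {1..?h}" for w
  proof -
    define j where "j = js ! (w - 1)"
    have wl: "w - 1 < length js" using w js by auto
    have jJ: "j \<in> J" unfolding j_def using nth_mem[OF wl] js by simp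
    define v where "v = nth1 y j"
    define U where "U = {j'\<in>J. j \<le> j'}"
    define D where "D = {i\<in>I. nth1 x i < v}"
    define E where "E = {i\<in>?ND. nth1 x i < v}"
    have U: "U = (\<lambda>i. js ! (i - 1)) ` {w..?h}"
    proof (intro equalityI subsetI)
      fix j' assume "j' \<in> U"
      then have "j' \<in> set js" "j \<le> j'" using js by (auto simp: U_def)
      then obtain k where k: "k < length js" "j' = js ! k" by (auto simp: in_set_conv_nth)
      have "w - 1 \<le> k"
      proof (rule ccontr)
        assume c: "\<not> w - 1 \<le> k"
        then have "js ! k \<le> js ! (w - 1)" using sorted_nth_mono[OF js(3)] wl by simp
        then have "js ! k = js ! (w - 1)" using \<open>j \<le> j'\<close> k by (simp add: j_def)
        then show False using c js(4) k wl by (simp add: nth_eq_iff_index_eq)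
      qed
      then show "j' \<in> (\<lambda>i. js ! (i - 1)) ` {w..?h}"
        using k js(1) by (intro image_eqI[of _ _ "Suc k"]) auto
    next
      fix j' assume "j' \<in> (\<lambda>i. js ! (i - 1)) ` {w..?h}"
      then obtain i where i: "w \<le> i" "i \<le> ?h" "j' = js ! (i - 1)" by auto
      then have il: "i - 1 < length js" using js w by auto
      then have "j' \<in> J" using nth_mem[OF il] js(2) i by simp
      moreover have "j \<le> j'"
        unfolding j_def i(3) using i il by (intro sorted_nth_mono[OF js(3)]) auto
      ultimately show "j' \<in> U" by (simp add: U_def)
    qed
    have inj: "inj_on (\<lambda>i. js ! (i - 1)) {w..?h}"
      using js w by (auto simp: inj_on_def nth_eq_iff_index_eq)
    have cU: "int (card U) = int ?h - int w + 1"
      unfolding U using card_image[OF inj] w by simp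
    have sU: "(\<Sum>i\<in>{w..?h}. sub_elem y J i) = (\<Sum>j'\<in>U. nth1 y j')"
      unfolding U sum.reindex[OF inj] by (simp add: sub_elem_def js_def)
    have cw: "sub_elem y J w = v"
      by (simp add: sub_elem_def v_def j_def js_def)
    define P where "P = length x - cnt_less x v"
    define R where "R = length u - cnt_less u (v + 1)"
    have mw: "int (card {i\<in>{1..length u}. nth1 u i > v}) = int R"
      unfolding R_def by (simp only: card_greater_indices[OF pu])
    have vnot: "nth1 x i \<noteq> v" if "i \<in> {1..length x}" for i
    proof -
      have "nth1 x i \<in> set x" using that by (intro nth1_in_set) auto
      moreover have "v \<in> set y" unfolding v_def using jJ J by (intro nth1_in_set) auto
      ultimately show ?thesis using disj by auto
    qed
    have cnt: "cnt_less x (v + 1) = cnt_less x v"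
    proof -
      have "{i\<in>{1..length x}. nth1 x i < v + 1} = {i\<in>{1..length x}. nth1 x i < v}"
        using vnot by force
      then show ?thesis using card_less_indices[OF px] by metis
    qed
    have zw: "int (card {i\<in>{1..length x}. nth1 x i > v}) = int P"
      unfolding P_def by (simp only: card_greater_indices[OF px] cnt)
    have DE: "{i\<in>{1..length x}. nth1 x i < v} = D \<union> E" "D \<inter> E = {}" "finite D" "finite E"
      using I finI by (auto simp: D_def E_def)
    have cDE: "cnt_less x v = card D + card E"
      using card_Un_disjoint[OF DE(3,4,2)] card_less_indices[OF px, of v] DE(1) by simp
    have P: "P \<le> length x" "cnt_less x v \<le> length x" "R \<le> length u" "cnt_less u (v + 1) \<le> length u"
      using below_eq_cnt(3)[OF px] below_eq_cnt(3)[OF pu] by (auto simp: P_def R_def)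
    have E: "{i\<in>?ND. int i \<ge> int P + 1} = E"
    proof -
      have "nth1 x i < v \<longleftrightarrow> P + 1 \<le> i" if "i \<in> {1..length x}" for i
      proof -
        have "i \<in> {i\<in>{1..length x}. nth1 x i < v} \<longleftrightarrow> i \<in> {P + 1..length x}"
          unfolding P_def by (simp only: less_indices[OF px])
        then show ?thesis using that by simp
      qed
      then have "nth1 x i < v \<longleftrightarrow> int P + 1 \<le> int i" if "i \<in> {1..length x}" for i
        using that by (metis Suc_eq_plus1 of_nat_Suc of_nat_le_iff add.commute)
      then show ?thesis unfolding E_def by blast
    qed
    have sx: "sum_list (drop P x) = (\<Sum>i\<in>D. nth1 x i) + (\<Sum>i\<in>E. nth1 x i)"
    proof -
      have "sum_list (drop P x) = (\<Sum>i\<in>{i\<in>{1..length x}. nth1 x i < v}. nth1 x i)"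
        unfolding less_indices[OF px] P_def[symmetric] by (rule sum_drop_nth1[OF P(1)])
      also have "\<dots> = (\<Sum>i\<in>D. nth1 x i) + (\<Sum>i\<in>E. nth1 x i)"
        unfolding DE(1) by (rule sum.union_disjoint[OF DE(3,4,2)])
      finally show ?thesis .
    qed
    have tailU: "esum u (int R + 1) (int (length u)) = ereal (sum_list (drop R u))"
      using P by (intro esum_tail) auto
    define N where "N = card U + card D"
    define \<sigma> where "\<sigma> = (\<Sum>j'\<in>U. nth1 y j') + (\<Sum>i\<in>D. nth1 x i)"
    define L where "L = length x + length u"
    have entry: "entry x y I J j = (v, N, \<sigma>)"
      by (simp add: entry_def N_def \<sigma>_def U_def D_def v_def)
    have PR: "P + R \<le> L" using P unfolding L_def by simp
    have cond1: "cond w \<longleftrightarrow> (int (length u) - (int ?h - int w) + int (card E) \<le> int R \<longrightarrow>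
       esum ?e (int P + (int (length u) - (int ?h - int w) + int (card E))) (int P + int R)
         \<le> ereal (\<Sum>j'\<in>U. nth1 y j') - ereal (\<Sum>i\<in>E. nth1 x i) - ereal (sum_list (drop R u)))"
      unfolding cond_def Let_def cw mw zw E sU E_def[symmetric] tailU ..
    \<comment> \<open>The block starts at \<open>z_y + t_y\<close>; counted from 1, this is where
      the last \<open>N\<close> of the \<open>L\<close> entries begin.\<close>
    have tw: "int P + (int (length u) - (int ?h - int w) + int (card E)) = int L + 1 - int N"
      using cU cDE P unfolding N_def L_def P_def by simp
    have tm: "int (length u) - (int ?h - int w) + int (card E) \<le> int R \<longleftrightarrow> \<not> upto_val u (N - cnt_less x v) v"
    proof -
      have "upto_val u (N - cnt_less x v) v \<longleftrightarrow> N - cnt_less x v \<le> cnt_less u (v + 1)"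
        unfolding upto_val_eq_below by (rule below_eq_cnt(1)[OF pu])
      then show ?thesis
        using cU cDE P unfolding N_def R_def by linarith
    qed
    have main: "esum ?e (int L + 1 - int N) (int P + int R)
         \<le> ereal (\<Sum>j'\<in>U. nth1 y j') - ereal (\<Sum>i\<in>E. nth1 x i) - ereal (sum_list (drop R u)) \<longleftrightarrow>
       N \<le> L \<and> sum_list (drop (L - N) ?e) \<le> \<sigma>" if nu: "\<not> upto_val u (N - cnt_less x v) v"
    proof (cases "N \<le> L")
      case True
      have big: "L - N \<le> P + R"
        using nu P True unfolding upto_val_eq_below below_eq_cnt(1)[OF pu] L_def P_def R_def by linarith
      have "esum ?e (int L + 1 - int N) (int P + int R)
          = ereal (real_of_int (sum_list (drop (L - N) ?e) - sum_list (drop (P + R) ?e)))"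
        using esum_segment[OF big, of ?e] PR True by (simp add: length_union_seq L_def add.commute add_diff_eq)
      moreover have "sum_list (drop (P + R) ?e) = sum_list (drop P x) + sum_list (drop R u)"
      proof (rule union_tail_eq[OF px pu P(1,3)])
        show "u ! R \<le> x ! (P - 1)" if "0 < P" "R < length u"
        proof -
          have "R \<in> {i. i < length u \<and> u ! i < v + 1}"
            unfolding below_eq_cnt(2)[OF pu] using that by (simp add: R_def)
          moreover have "P - 1 \<notin> {i. i < length x \<and> x ! i < v}"
            unfolding below_eq_cnt(2)[OF px] using that by (auto simp: P_def)
          ultimately show ?thesis using that P by auto
        qed
        show "x ! P \<le> u ! (R - 1)" if "0 < R" "P < length x"
        proof -
          have "P \<in> {i. i < length x \<and> x ! i < v}"
            unfolding below_eq_cnt(2)[OF px] using that by (simp add: P_def)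
          moreover have "R - 1 \<notin> {i. i < length u \<and> u ! i < v + 1}"
            unfolding below_eq_cnt(2)[OF pu] using that by (auto simp: R_def)
          ultimately show ?thesis using that P by auto
        qed
      qed
      ultimately show ?thesis
        using True sx unfolding \<sigma>_def by (simp flip: of_int_add of_int_diff of_int_sum add: algebra_simps)
    next
      case False
      \<comment> \<open>The block now starts at an index at most 0, so its sum is infinite and both
        sides are false.\<close>
      have "esum ?e (int L + 1 - int N) (int P + int R) = \<infinity>"
        by (rule esum_PInf) (use False in auto)
      then show ?thesis using False by simp
    qed
    show ?thesis
      unfolding j_def[symmetric] entry using cond1 main unfolding tw tm
      by (auto simp: tail_cond_def L_def)
  qed
  have "(\<lambda>w. js ! (w - 1)) ` {1..?h} = J"
  proof -
    have "{1..?h} = Suc ` {0..<?h}"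
      unfolding image_Suc_atLeastLessThan by auto
    then have "(\<lambda>w. js ! (w - 1)) ` {1..?h} = (!) js ` {0..<length js}"
      unfolding js(1) by (simp only: image_image diff_Suc_1)
    also have "\<dots> = J" using nth_image[of "length js" js] js(2) by simp
    finally show ?thesis .
  qed
  then have "entry x y I J ` J = (\<lambda>w. entry x y I J (js ! (w - 1))) ` {1..?h}"
    by (metis image_image)
  then have "(\<forall>(v, N, \<sigma>)\<in>entry x y I J ` J. tail_cond x u v N \<sigma>) \<longleftrightarrow>
      (\<forall>w\<in>{1..?h}. case entry x y I J (js ! (w - 1)) of (v, N, \<sigma>) \<Rightarrow> tail_cond x u v N \<sigma>)"
    by (simp only: ball_simps(9))
  then show ?thesis using cs cond by (simp only: cong: ball_cong)
qed

section \<open>The whole process, and the equivalence\<close>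

lemma state_step:
  assumes px: "is_partition x" and py: "is_partition y" and pu: "is_partition u"
    and disj: "set x \<inter> set y = {}"
    and inv: "state_inv x u y w (Suc p) q I J G"
    and less: "0 < q \<Longrightarrow> nth1 x (Suc p) < nth1 y q"
  shows "\<exists>G'. state_inv x u y w p q
      (if goes_in x u y J ({Suc p + 1..length x} - I) (Suc p) then insert (Suc p) I else I) J G' \<and>
    (\<forall>g. is_partition g \<longrightarrow> length g = length x + length u \<longrightarrow> wgmaj g x u \<longrightarrow>
      dominated g G \<longrightarrow> dominated g G')"
proof -
  have rx: "run x u (Suc p) G" and J: "J \<subseteq> {q + 1..length y}"
    and ordy: "\<forall>j\<in>{q + 1..length y}. nth1 y j < nth1 x (Suc p)"
    using inv by (auto simp: state_inv_def side_inv_def)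
  have goes: "goes_in x u y J ({Suc p + 1..length x} - I) (Suc p) \<longleftrightarrow> \<not> drops x u p G"
    by (rule goes_in_iff[OF px pu inv disj]) (use J ordy in blast)
  note step = state_inv_step[OF px py pu disj inv less]
  show ?thesis
  proof (cases "drops x u p G")
    case True
    then show ?thesis using step(1) goes by auto
  next
    case False
    have "dominated g (nth1 x (Suc p) # G)"
      if "is_partition g" "length g = length x + length u" "wgmaj g x u" "dominated g G" for g
      using dominated_keep[OF px pu that(1-3) _ _ False that(4)] run_basic[OF rx px]
      by (simp add: nth1_def)
    then show ?thesis using step(2) goes False by auto
  qed
qed

theorem theorem4p1:
  fixes a b c d :: "int list" and m n s k :: nat
  assumes "m > 0" "n > 0" "s > 0" "k > 0" "m + s = n + k"
    and "length a = s" "length b = k" "length c = n" "length d = m"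
    and "is_partition a" "is_partition b" "is_partition c" "is_partition d"
    and "\<forall>i\<in>{1..n}. \<forall>j\<in>{1..m}. nth1 c i \<noteq> nth1 d j"
  shows "(\<exists>g. is_partition g \<and> length g = m + s \<and> wgmaj g d a \<and> wgmaj g c b)
         \<longleftrightarrow> (cond_side c a d (Sset a b c d) (Dset a b c d)
              \<and> cond_side d b c (Dset a b c d) (Sset a b c d))"
proof -
  note lens = assms(5-9) and parts = assms(10-13)
  have disj: "set d \<inter> set c = {}"
  proof -
    have *: "d ! j \<noteq> c ! i" if "j < m" "i < n" for i j
      using assms(14)[rule_format, of "Suc i" "Suc j"] that by (auto simp: nth1_def)
    show ?thesis
    proof (rule equals0I)
      fix z assume "z \<in> set d \<inter> set c"
      then obtain j i where "j < m" "d ! j = z" "i < n" "c ! i = z"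
        using lens by (auto simp: in_set_conv_nth)
      then show False using *[of j i] by simp
    qed
  qed
  define feasible where "feasible g \<longleftrightarrow> is_partition g \<and> length g = m + s \<and> wgmaj g d a \<and> wgmaj g c b" for g
  \<comment> \<open>The loop invariant: one list \<open>G\<close>, determined by the construction,
    dominates all solutions at once.\<close>
  define good where "good pc pd S D \<longleftrightarrow>
    (\<exists>G. state_inv d a c b pd pc D S G \<and> (\<forall>g. feasible g \<longrightarrow> dominated g G))" for pc pd S D
  define st where "st i = (SD_step a b c d ^^ i) (n, m, {}, {})" for i
  have "case st i of (pc, pd, S, D) \<Rightarrow> pc + pd = n + m - i \<and> good pc pd S D" if "i \<le> n + m" for i
    using that
  proof (induction i)
    case 0
    have "state_inv d a c b m n {} {} []"
      using run.init[of d a] run.init[of c b] lens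
      by (simp add: state_inv_def side_inv_def entries_def)
    then show ?case by (auto simp: st_def good_def dominated_Nil)
  next
    case (Suc i)
    obtain pc pd S D where sti: "st i = (pc, pd, S, D)" by (metis prod_cases4)
    with Suc have sum: "pc + pd = n + m - i" and "good pc pd S D" by auto
    then obtain G where inv: "state_inv d a c b pd pc D S G" and dom: "\<And>g. feasible g \<Longrightarrow> dominated g G"
      unfolding good_def by blast
    have suc: "st (Suc i) = SD_step a b c d (pc, pd, S, D)" by (simp add: st_def flip: sti)
    have pcn: "pc \<le> n" "pd \<le> m"
      using inv run_basic[of d a pd G] run_basic[of c b pc G] parts lens
      by (auto simp: state_inv_def side_inv_def)
    show ?case
    proof (cases "pd > 0 \<and> (pc = 0 \<or> nth1 d pd < nth1 c pc)")
      case True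
      then obtain p where p: "pd = Suc p" using gr0_implies_Suc by blast
      obtain G' where "state_inv d a c b p pc
          (if goes_in d a c S ({Suc p + 1..length d} - D) (Suc p) then insert (Suc p) D else D) S G'"
        "\<And>g. feasible g \<Longrightarrow> dominated g G'"
        using state_step[OF parts(4,3,1) disj inv[unfolded p]] True dom lens unfolding p feasible_def by auto
      then show ?thesis
        using True sum Suc.prems unfolding suc SD_step_def p good_def by (auto simp: Let_def)
    next
      case False
      have "pc > 0" using sum Suc.prems False by auto
      then obtain p where p: "pc = Suc p" using gr0_implies_Suc by blast
      \<comment> \<open>The else branch gives only a weak inequality; it is strict because no
        \<open>c\<close> equals a \<open>d\<close>.\<close>
      have less: "nth1 c (Suc p) < nth1 d pd" if "0 < pd"
      proof -
        have "nth1 c pc \<noteq> nth1 d pd"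
          using assms(14) that \<open>pc > 0\<close> pcn by simp
        then show ?thesis using False that unfolding p by auto
      qed
      have disj': "set c \<inter> set d = {}" using disj by auto
      have inv': "state_inv c b d a (Suc p) pd S D G"
        using inv state_inv_sym unfolding p by blast
      obtain G' where "state_inv c b d a p pd
          (if goes_in c b d D ({Suc p + 1..length c} - S) (Suc p) then insert (Suc p) S else S) D G'"
        "\<And>g. feasible g \<Longrightarrow> dominated g G'"
        using state_step[OF parts(3,4,2) disj' inv' less] dom lens unfolding feasible_def by auto
      then show ?thesis
        using False sum Suc.prems state_inv_sym unfolding suc SD_step_def p good_def by (auto simp: Let_def)
    qed
  qed
  from this[of "n + m"]
  have "case st (n + m) of (pc, pd, S, D) \<Rightarrow> pc = 0 \<and> pd = 0 \<and> good 0 0 S D" by auto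
  moreover have "Sset a b c d = fst (snd (snd (st (n + m))))" "Dset a b c d = snd (snd (snd (st (n + m))))"
    using lens by (auto simp: Sset_def Dset_def SD_final_def st_def split: prod.splits)
  ultimately have "good 0 0 (Sset a b c d) (Dset a b c d)" by (auto split: prod.splits)
  then obtain G where inv: "state_inv d a c b 0 0 (Dset a b c d) (Sset a b c d) G"
    and dom: "\<And>g. feasible g \<Longrightarrow> dominated g G"
    unfolding good_def by blast
  let ?S = "Sset a b c d" and ?D = "Dset a b c d"
  have runs: "run d a 0 G" "run c b 0 G" and setG: "set G \<subseteq> set d \<union> set c"
    and sub: "?D \<subseteq> {1..length d}" "?S \<subseteq> {1..length c}"
    and ent: "entries G (set c) = entry d c ?D ?S ` ?S" "entries G (set d) = entry c d ?S ?D ` ?D"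
    using inv by (auto simp: state_inv_def side_inv_def)
  have i: "cond_side c a d ?S ?D \<longleftrightarrow> tail_conds d a G"
    unfolding cond_side_iff[OF parts(4,1) disj sub]
    using tail_conds_entries[OF setG disj] ent by simp
  have ii: "cond_side d b c ?D ?S \<longleftrightarrow> tail_conds c b G"
  proof -
    have disj': "set c \<inter> set d = {}" and setG': "set G \<subseteq> set c \<union> set d" using disj setG by auto
    show ?thesis
      unfolding cond_side_iff[OF parts(3,2) disj' sub(2,1)]
      using tail_conds_entries[OF setG' disj'] ent by simp
  qed
  show ?thesis
    unfolding i ii
  proof
    assume "\<exists>g. is_partition g \<and> length g = m + s \<and> wgmaj g d a \<and> wgmaj g c b"
    then obtain g where g: "feasible g" by (auto simp: feasible_def)
    then show "tail_conds d a G \<and> tail_conds c b G"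
      using dominated_tail_conds[OF _ _ _ dom[OF g]] lens unfolding feasible_def by auto
  next
    assume conds: "tail_conds d a G \<and> tail_conds c b G"
    \<comment> \<open>One bound for both sides, so that the same padded list is a solution for
      \<open>(d, a)\<close> and for \<open>(c, b)\<close>.\<close>
    define M where "M = Max (insert 0 (set a \<union> set b \<union> set c \<union> set d \<union> set G)) + 1"
    have M: "z < M" if "z \<in> set a \<union> set b \<union> set c \<union> set d \<union> set G" for z
      unfolding M_def using that by (intro zle_add1_eq_le[THEN iffD2] Max_ge) auto
    let ?g = "replicate (m + s - length G) M @ G"
    have "length G \<le> m + s" "is_partition ?g" "wgmaj ?g d a"
      using run_feasible[OF parts(4,1) runs(1), of M] conds M lens by auto
    moreover have "wgmaj ?g c b"
      using run_feasible(3)[OF parts(3,2) runs(2), of M] conds M lens by auto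
    ultimately show "\<exists>g. is_partition g \<and> length g = m + s \<and> wgmaj g d a \<and> wgmaj g c b"
      by (intro exI[of _ ?g]) simp
  qed
qed

end
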